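(* For every odd prime $p$, the graph $G_p$ is hyperenergetic; that is, $$\mathcal{E}(G_p)>2\bigl(|V(G_p)|-1\bigr)=\mathcal{E}\bigl(K_{|V(G_p)|}\bigr).$$
   Context: For $n\ge2$, $\mathbb{L}_n=\{a+bi+cj+dk: a,b,c,d\in\mathbb{Z}/n\mathbb{Z}\}$ is the ring of Lipschitz quaternions modulo $n$, with the usual relations $i^2=j^2=k^2=-1$, $ij=k=-ji$, $jk=i=-kj$, $ki=j=-ik$ taken modulo $n$. A nonzero element $x$ of a ring is a zero divisor if $xy=0$ or $yx=0$ for some nonzero $y$. $G_n=\Gamma(\mathbb{L}_n)$ is the simple undirected graph whose vertices are the nonzero zero divisors of $\mathbb{L}_n$, distinct $x,y$ being adjacent iff $xy=0$ or $yx=0$. (For odd primes $p$, $\mathbb{L}_p\cong M_2(\mathbb{F}_p)$.) The energy $\mathcal{E}(G)$ of a graph $G$ is the sum of the absolute values of the eigenvalues (with multiplicity) of its adjacency matrix. $K_m$ is the complete graph on $m$ vertices. *)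

theory Defs
  imports
    "HOL-Algebra.Ring"
    "HOL-Computational_Algebra.Primes"
    "Graph_Theory.Graph_Theory"
    "Jordan_Normal_Form.Spectral_Radius"
begin

text \<open>The quadruple \<open>(a, b, c, d)\<close> of residues in \<open>{0..<n}\<close> stands for \<open>a + bi + cj + dk\<close>;
  the product is the bilinear extension of \<open>i\<^sup>2 = j\<^sup>2 = k\<^sup>2 = -1\<close>, \<open>ij = k = -ji\<close>, \<open>jk = i = -kj\<close>,
  \<open>ki = j = -ik\<close>, reduced modulo \<open>n\<close>.\<close>

type_synonym quat = "int \<times> int \<times> int \<times> int"

definition quat_add :: "nat \<Rightarrow> quat \<Rightarrow> quat \<Rightarrow> quat" where
  "quat_add n = (\<lambda>(a, b, c, d) (a', b', c', d').
     ((a + a') mod int n, (b + b') mod int n, (c + c') mod int n, (d + d') mod int n))"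

definition quat_mult :: "nat \<Rightarrow> quat \<Rightarrow> quat \<Rightarrow> quat" where
  "quat_mult n = (\<lambda>(a, b, c, d) (a', b', c', d').
     ((a * a' - b * b' - c * c' - d * d') mod int n,
      (a * b' + b * a' + c * d' - d * c') mod int n,
      (a * c' - b * d' + c * a' + d * b') mod int n,
      (a * d' + b * c' - c * b' + d * a') mod int n))"

definition lipschitz_ring :: "nat \<Rightarrow> quat ring" where
  "lipschitz_ring n =
     \<lparr>carrier = {0..<int n} \<times> {0..<int n} \<times> {0..<int n} \<times> {0..<int n},
      monoid.mult = quat_mult n, one = (1, 0, 0, 0),
      zero = (0, 0, 0, 0), add = quat_add n\<rparr>"

lemma lipschitz_ring_relations:
  fixes n :: nat
  assumes "n \<ge> 2"
  defines "R \<equiv> lipschitz_ring n"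
    and "i \<equiv> (0, 1, 0, 0)" and "j \<equiv> (0, 0, 1, 0)" and "k \<equiv> (0, 0, 0, 1)"
    and "neg \<equiv> \<lambda>(a, b, c, d). ((- a) mod int n, (- b) mod int n, (- c) mod int n, (- d) mod int n)"
  shows "i \<otimes>\<^bsub>R\<^esub> i = neg \<one>\<^bsub>R\<^esub>" "j \<otimes>\<^bsub>R\<^esub> j = neg \<one>\<^bsub>R\<^esub>" "k \<otimes>\<^bsub>R\<^esub> k = neg \<one>\<^bsub>R\<^esub>"
    "i \<otimes>\<^bsub>R\<^esub> j = k" "j \<otimes>\<^bsub>R\<^esub> i = neg k"
    "j \<otimes>\<^bsub>R\<^esub> k = i" "k \<otimes>\<^bsub>R\<^esub> j = neg i"
    "k \<otimes>\<^bsub>R\<^esub> i = j" "i \<otimes>\<^bsub>R\<^esub> k = neg j"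
  using assms(1) by (simp_all add: assms(2-) lipschitz_ring_def quat_mult_def)

lemma quat_mult_mod:
  "quat_mult n (a mod int n, b mod int n, c mod int n, d mod int n) y = quat_mult n (a, b, c, d) y"
  "quat_mult n y (a mod int n, b mod int n, c mod int n, d mod int n) = quat_mult n y (a, b, c, d)"
  by (cases y; simp add: quat_mult_def;
      intro conjI mod_add_cong mod_diff_cong mod_mult_cong mod_mod_trivial refl)+

lemma quat_mult_assoc: "quat_mult n (quat_mult n x y) z = quat_mult n x (quat_mult n y z)"
proof -
  obtain a b c d where x: "x = (a, b, c, d)" by (cases x)
  obtain a' b' c' d' where y: "y = (a', b', c', d')" by (cases y)
  obtain a'' b'' c'' d'' where z: "z = (a'', b'', c'', d'')" by (cases z)
  have "quat_mult n (quat_mult n x y) z = quat_mult n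
     (a * a' - b * b' - c * c' - d * d', a * b' + b * a' + c * d' - d * c',
      a * c' - b * d' + c * a' + d * b', a * d' + b * c' - c * b' + d * a') z"
    unfolding x y quat_mult_def[of n, THEN fun_cong, of "(a, b, c, d)"]
    by (simp add: quat_mult_mod)
  moreover have "quat_mult n x (quat_mult n y z) = quat_mult n x
     (a' * a'' - b' * b'' - c' * c'' - d' * d'', a' * b'' + b' * a'' + c' * d'' - d' * c'',
      a' * c'' - b' * d'' + c' * a'' + d' * b'', a' * d'' + b' * c'' - c' * b'' + d' * a'')"
    unfolding y z quat_mult_def[of n, THEN fun_cong, of "(a', b', c', d')"]
    by (simp add: quat_mult_mod)
  ultimately show ?thesis
    by (simp add: x z quat_mult_def algebra_simps)
qed

lemma quat_mult_distrib:
  "quat_mult n (quat_add n x y) z = quat_add n (quat_mult n x z) (quat_mult n y z)"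
  "quat_mult n z (quat_add n x y) = quat_add n (quat_mult n z x) (quat_mult n z y)"
proof -
  obtain a b c d where x: "x = (a, b, c, d)" by (cases x)
  obtain a' b' c' d' where y: "y = (a', b', c', d')" by (cases y)
  obtain a'' b'' c'' d'' where z: "z = (a'', b'', c'', d'')" by (cases z)
  have s: "quat_add n x y = ((a + a') mod int n, (b + b') mod int n, (c + c') mod int n, (d + d') mod int n)"
    by (simp add: x y quat_add_def)
  show "quat_mult n (quat_add n x y) z = quat_add n (quat_mult n x z) (quat_mult n y z)"
    unfolding s quat_mult_mod
    by (simp only: x y z quat_mult_def quat_add_def prod.case mod_simps) (simp add: algebra_simps)
  show "quat_mult n z (quat_add n x y) = quat_add n (quat_mult n z x) (quat_mult n z y)"
    unfolding s quat_mult_mod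
    by (simp only: x y z quat_mult_def quat_add_def prod.case mod_simps) (simp add: algebra_simps)
qed

lemma ring_lipschitz_ring:
  assumes "n \<ge> 2"
  shows "Ring.ring (lipschitz_ring n)"
proof (rule ringI)
  show "abelian_group (lipschitz_ring n)"
  proof (rule abelian_groupI)
    fix x assume "x \<in> carrier (lipschitz_ring n)"
    then obtain a b c d where x: "x = (a, b, c, d)" by (cases x)
    let ?y = "((- a) mod int n, (- b) mod int n, (- c) mod int n, (- d) mod int n)"
    have "?y \<in> carrier (lipschitz_ring n)"
      using assms by (simp add: lipschitz_ring_def)
    moreover have "?y \<oplus>\<^bsub>lipschitz_ring n\<^esub> x = \<zero>\<^bsub>lipschitz_ring n\<^esub>"
      by (simp add: x lipschitz_ring_def quat_add_def mod_simps)
    ultimately show "\<exists>y\<in>carrier (lipschitz_ring n). y \<oplus>\<^bsub>lipschitz_ring n\<^esub> x = \<zero>\<^bsub>lipschitz_ring n\<^esub>"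
      by blast
  qed (use assms in \<open>auto simp: lipschitz_ring_def quat_add_def mod_simps algebra_simps\<close>)
  show "Group.monoid (lipschitz_ring n)"
  proof (rule monoidI)
    fix x y z
    show "x \<otimes>\<^bsub>lipschitz_ring n\<^esub> y \<otimes>\<^bsub>lipschitz_ring n\<^esub> z =
        x \<otimes>\<^bsub>lipschitz_ring n\<^esub> (y \<otimes>\<^bsub>lipschitz_ring n\<^esub> z)"
      by (simp add: lipschitz_ring_def quat_mult_assoc)
  qed (use assms in \<open>auto simp: lipschitz_ring_def quat_mult_def\<close>)
qed (simp_all add: lipschitz_ring_def quat_mult_distrib)

definition zero_divisors :: "('a, 'b) ring_scheme \<Rightarrow> 'a set" where
  "zero_divisors R =
     {x \<in> carrier R. x \<noteq> \<zero>\<^bsub>R\<^esub> \<and>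
        (\<exists>y\<in>carrier R. y \<noteq> \<zero>\<^bsub>R\<^esub> \<and> (x \<otimes>\<^bsub>R\<^esub> y = \<zero>\<^bsub>R\<^esub> \<or> y \<otimes>\<^bsub>R\<^esub> x = \<zero>\<^bsub>R\<^esub>))}"

text \<open>As in the entry \<open>Graph_Theory\<close>, a simple undirected graph is a loop-free symmetric digraph,
  an edge being a pair of opposite arcs.\<close>

definition zero_divisor_graph :: "('a, 'b) ring_scheme \<Rightarrow> 'a pair_pre_digraph" where
  "zero_divisor_graph R =
     \<lparr>pverts = zero_divisors R,
      parcs = {(x, y). x \<in> zero_divisors R \<and> y \<in> zero_divisors R \<and> x \<noteq> y \<and>
                       (x \<otimes>\<^bsub>R\<^esub> y = \<zero>\<^bsub>R\<^esub> \<or> y \<otimes>\<^bsub>R\<^esub> x = \<zero>\<^bsub>R\<^esub>)}\<rparr>"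

lemma pair_graph_zero_divisor_graph:
  assumes "finite (carrier R)"
  shows "pair_graph (zero_divisor_graph R)"
proof -
  have fin: "finite (zero_divisors R)"
    using assms by (simp add: zero_divisors_def)
  have "parcs (zero_divisor_graph R) \<subseteq> zero_divisors R \<times> zero_divisors R"
    by (auto simp: zero_divisor_graph_def)
  hence "finite (parcs (zero_divisor_graph R))"
    using fin finite_subset by blast
  thus ?thesis
    using fin by unfold_locales (auto simp: zero_divisor_graph_def symmetric_def sym_def)
qed

definition complete_graph :: "nat \<Rightarrow> nat pair_pre_digraph" where
  "complete_graph m =
     \<lparr>pverts = {0..<m}, parcs = {(u, v). u \<in> {0..<m} \<and> v \<in> {0..<m} \<and> u \<noteq> v}\<rparr>"

lemma complete_digraph_complete_graph: "complete_digraph m (with_proj (complete_graph m))"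
  unfolding complete_digraph_pair_def by (auto simp: complete_graph_def)

definition adjacency_matrix :: "'a pair_pre_digraph \<Rightarrow> 'a list \<Rightarrow> complex mat" where
  "adjacency_matrix G vs =
     mat (length vs) (length vs) (\<lambda>(i, j). if (vs ! i, vs ! j) \<in> parcs G then 1 else 0)"

text \<open>Eigenvalues are counted with their algebraic multiplicity, which for the symmetric matrices
  considered here is also the geometric one.\<close>

definition matrix_energy :: "complex mat \<Rightarrow> real" where
  "matrix_energy A = (\<Sum>l\<in>spectrum A. real (Polynomial.order l (char_poly A)) * cmod l)"

text \<open>The choice of the enumeration of the vertices is immaterial, see \<open>graph_energy_eq\<close> below.\<close>

definition graph_energy :: "'a pair_pre_digraph \<Rightarrow> real" where
  "graph_energy G =
     matrix_energy (adjacency_matrix G (SOME vs. distinct vs \<and> set vs = pverts G))"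

lemma similar_mat_reindex:
  fixes A :: "complex mat"
  assumes A: "A \<in> carrier_mat n n" and s: "bij_betw s {0..<n} {0..<n}"
  shows "similar_mat (mat n n (\<lambda>(i, j). A $$ (s i, s j))) A"
proof -
  define P where "P = mat n n (\<lambda>(i, j). if j = s i then 1 else 0 :: complex)"
  define Q where "Q = mat n n (\<lambda>(i, j). if i = s j then 1 else 0 :: complex)"
  have PC: "P \<in> carrier_mat n n" "Q \<in> carrier_mat n n" by (auto simp: P_def Q_def)
  have s_lt: "s i < n" if "i < n" for i
    using bij_betwE[OF s] that by simp
  have s_inj: "s i = s j \<longleftrightarrow> i = j" if "i < n" "j < n" for i j
    using bij_betw_imp_inj_on[OF s] that by (auto simp: inj_on_def)
  have PQ: "P * Q = 1\<^sub>m n"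
    by (rule eq_matI)
      (auto simp: P_def Q_def scalar_prod_def s_lt s_inj if_distrib[of "\<lambda>x. x * _"] sum.delta'
        cong: if_cong)
  have QP: "Q * P = 1\<^sub>m n" using mat_mult_left_right_inverse[OF PC PQ] .
  have "mat n n (\<lambda>(i, j). A $$ (s i, s j)) = P * A * Q"
  proof (rule eq_matI)
    fix i j assume "i < dim_row (P * A * Q)" "j < dim_col (P * A * Q)"
    hence ij: "i < n" "j < n" using PC by auto
    have PA: "(P * A) $$ (i, k) = A $$ (s i, k)" if "k < n" for k
      using that ij A
      by (simp add: P_def scalar_prod_def s_lt if_distrib[of "\<lambda>x. x * _"] cong: if_cong)
    have "(P * A * Q) $$ (i, j) = (\<Sum>k = 0..<n. (P * A) $$ (i, k) * Q $$ (k, j))"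
    proof -
      have "(P * A * Q) $$ (i, j) = row (P * A) i \<bullet> col Q j"
        using ij PC by (intro index_mult_mat(1)) auto
      also have "\<dots> = (\<Sum>k = 0..<n. row (P * A) i $ k * col Q j $ k)"
        using PC by (simp add: scalar_prod_def)
      also have "\<dots> = (\<Sum>k = 0..<n. (P * A) $$ (i, k) * Q $$ (k, j))"
        using ij A PC by (intro sum.cong refl arg_cong2[of _ _ _ _ "(*)"] index_row(1) index_col) auto
      finally show ?thesis .
    qed
    also have "\<dots> = (\<Sum>k = 0..<n. if k = s j then A $$ (s i, k) else 0)"
      by (rule sum.cong) (use ij PA in \<open>auto simp: Q_def\<close>)
    also have "\<dots> = A $$ (s i, s j)" using s_lt ij by simp
    finally show "mat n n (\<lambda>(i, j). A $$ (s i, s j)) $$ (i, j) = (P * A * Q) $$ (i, j)"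
      using ij by simp
  qed (use PC A in auto)
  thus ?thesis using PQ QP PC A by (intro similar_matI[of _ _ P Q n]) auto
qed

lemma graph_energy_eq:
  assumes "distinct vs" "set vs = pverts G"
  shows "graph_energy G = matrix_energy (adjacency_matrix G vs)"
proof -
  define ws where "ws = (SOME vs. distinct vs \<and> set vs = pverts G)"
  have ws: "distinct ws" "set ws = pverts G"
    using someI[of "\<lambda>vs. distinct vs \<and> set vs = pverts G" vs] assms by (auto simp: ws_def)
  define n where "n = length vs"
  have n: "length vs = n" "length ws = n"
    using distinct_card[OF ws(1)] distinct_card[OF assms(1)] ws assms by (auto simp: n_def)
  have bv: "bij_betw ((!) vs) {0..<n} (pverts G)" and bw: "bij_betw ((!) ws) {0..<n} (pverts G)"
    using bij_betw_nth[OF assms(1)] bij_betw_nth[OF ws(1)] n ws assms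
    by (auto simp: atLeast0LessThan)
  define s where "s = the_inv_into {0..<n} ((!) vs) \<circ> (!) ws"
  have s: "bij_betw s {0..<n} {0..<n}"
    unfolding s_def using bw bij_betw_the_inv_into[OF bv] by (rule bij_betw_trans)
  have vs_s: "vs ! s i = ws ! i" if "i < n" for i
    using bv bij_betwE[OF bw] that f_the_inv_into_f_bij_betw[OF bv, of "ws ! i"]
    by (simp add: s_def)
  have s_lt: "s i < n" if "i < n" for i
    using bij_betwE[OF s] that by simp
  let ?A = "adjacency_matrix G vs" and ?B = "adjacency_matrix G ws"
  have AC: "?A \<in> carrier_mat n n" "?B \<in> carrier_mat n n" by (auto simp: adjacency_matrix_def n)
  have "?B = mat n n (\<lambda>(i, j). ?A $$ (s i, s j))"
    by (rule eq_matI) (auto simp: adjacency_matrix_def n vs_s s_lt)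
  hence cp: "char_poly ?B = char_poly ?A"
    using char_poly_similar[OF similar_mat_reindex[OF AC(1) s]] by simp
  have "spectrum ?B = spectrum ?A"
    using eigenvalue_root_char_poly[OF AC(1)] eigenvalue_root_char_poly[OF AC(2)] cp
    by (auto simp: spectrum_def)
  thus ?thesis using cp by (simp add: graph_energy_def matrix_energy_def ws_def)
qed

end

theory Submission
  imports Defs "HOL-Number_Theory.Cong"
begin

text \<open>
  For an odd prime \<open>p\<close> the ring is the ring of 2 by 2 matrices over the field with \<open>p\<close> elements, because
  \<open>-1\<close> is a sum of two squares modulo \<open>p\<close>. Its nonzero zero divisors are the matrices of rank one. Such a
  matrix is given by its image and its kernel, which are two of the \<open>m = p + 1\<close> points of the projective
  line, and by one of \<open>q = p - 1\<close> scalars; moreover \<open>x y = 0\<close> iff the image of \<open>y\<close> is the kernel of \<open>x\<close>. So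
  there are \<open>q m\<^sup>2\<close> vertices, and the adjacency matrix is, up to the loops, the \<open>q\<close>-fold blow-up of the
  relation \<open>b = a'\<close> or \<open>b' = a\<close> between pairs \<open>(a, b)\<close> and \<open>(a', b')\<close> of points (\<open>bij_betw_vertex\<close> and
  \<open>vertex_mult_eq_0_iff\<close>).

  The energy is bounded from below by duality: the sum of the absolute values of the eigenvalues of
  a Hermitian matrix \<open>A\<close> is at least the trace of \<open>A X\<close> for every Hermitian involution \<open>X\<close>
  (\<open>trace_mult_involution_le_energy\<close>), with equality if \<open>X\<close> is a sign of \<open>A\<close>. The blow-up with loops has
  an explicit sign \<open>X\<close>, and for the adjacency matrix \<open>A\<close> without loops the trace of \<open>A X\<close> is
  \<open>q (m\<^sup>2 + 2 (m - 1)\<^sup>2 + m) - 4 + 2 / m\<close> (\<open>pair_graph_energy_bound\<close>). This exceeds \<open>2 (q m\<^sup>2 - 1)\<close> by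
  \<open>p (p - 1)\<^sup>2 - 2 + 2 / m\<close>, which is positive.

  The energy of the complete graph follows from its only possible eigenvalues and its trace
  (\<open>graph_energy_complete_graph\<close>).
\<close>

section \<open>Unitary diagonalization of Hermitian matrices\<close>

definition mat_trace :: "'a :: comm_monoid_add mat \<Rightarrow> 'a" where
  "mat_trace A = (\<Sum>i<dim_row A. A $$ (i, i))"

lemma mat_adjoint_eq:
  "mat_adjoint A = mat (dim_col A) (dim_row A) (\<lambda>(i, j). conjugate (A $$ (j, i)))"
  by (rule eq_matI) (auto simp: mat_adjoint_def mat_of_rows_def)

lemma mat_adjoint_carrier [simp]:
  "A \<in> carrier_mat n m \<Longrightarrow> mat_adjoint A \<in> carrier_mat m n"
  by (auto simp: mat_adjoint_eq)

lemma mat_adjoint_adjoint [simp]: "mat_adjoint (mat_adjoint A) = A"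
  by (rule eq_matI) (auto simp: mat_adjoint_eq)

lemma index_mult_mat_sum:
  assumes "A \<in> carrier_mat n k" "B \<in> carrier_mat k m" "i < n" "j < m"
  shows "(A * B) $$ (i, j) = (\<Sum>l<k. A $$ (i, l) * B $$ (l, j))"
  using assms by (auto simp: scalar_prod_def atLeast0LessThan)

lemma mat_adjoint_mult:
  fixes A B :: "complex mat"
  assumes "A \<in> carrier_mat n k" "B \<in> carrier_mat k m"
  shows "mat_adjoint (A * B) = mat_adjoint B * mat_adjoint A"
proof (rule eq_matI)
  fix i j assume "i < dim_row (mat_adjoint B * mat_adjoint A)"
    "j < dim_col (mat_adjoint B * mat_adjoint A)"
  hence ij: "i < m" "j < n" using assms by (auto simp: mat_adjoint_eq)
  have "mat_adjoint (A * B) $$ (i, j) = cnj ((A * B) $$ (j, i))"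
    using assms ij by (auto simp: mat_adjoint_eq)
  also have "\<dots> = (\<Sum>l<k. cnj (A $$ (j, l) * B $$ (l, i)))"
    by (subst index_mult_mat_sum[OF assms]) (use ij in auto)
  also have "\<dots> = (\<Sum>l<k. mat_adjoint B $$ (i, l) * mat_adjoint A $$ (l, j))"
    by (rule sum.cong) (use ij assms in \<open>auto simp: mat_adjoint_eq\<close>)
  also have "\<dots> = (mat_adjoint B * mat_adjoint A) $$ (i, j)"
    by (subst index_mult_mat_sum[of _ m k _ n]) (use ij assms in auto)
  finally show "mat_adjoint (A * B) $$ (i, j) = (mat_adjoint B * mat_adjoint A) $$ (i, j)" .
qed (use assms in \<open>auto simp: mat_adjoint_eq\<close>)

lemma mat_trace_mult_commute:
  fixes A B :: "'a :: comm_semiring_0 mat"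
  assumes "A \<in> carrier_mat n m" "B \<in> carrier_mat m n"
  shows "mat_trace (A * B) = mat_trace (B * A)"
proof -
  have "mat_trace (A * B) = (\<Sum>i<n. \<Sum>j<m. A $$ (i, j) * B $$ (j, i))"
    unfolding mat_trace_def using assms index_mult_mat_sum[OF assms] by auto
  also have "\<dots> = (\<Sum>j<m. \<Sum>i<n. B $$ (j, i) * A $$ (i, j))"
    by (subst sum.swap) (simp add: mult.commute)
  also have "\<dots> = mat_trace (B * A)"
    unfolding mat_trace_def using assms index_mult_mat_sum[OF assms(2,1)] by auto
  finally show ?thesis .
qed

text \<open>Gram--Schmidt turns a basis that starts with \<open>v\<close> into an orthogonal one that still starts with
\<open>v\<close>; dividing each column by its length makes the matrix unitary.\<close>

lemma unitary_with_first_column: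
  fixes v :: "complex vec"
  assumes v: "v \<in> carrier_vec n" "v \<noteq> 0\<^sub>v n"
  obtains W c where "W \<in> carrier_mat n n" "mat_adjoint W * W = 1\<^sub>m n" "col W 0 = c \<cdot>\<^sub>v v"
proof -
  have n: "n > 0" using v by (cases n) auto
  define b where "b = basis_completion v"
  define ws where "ws = gram_schmidt n b"
  interpret cof_vec_space n "TYPE(complex)" .
  note bc = basis_completion[OF v, folded b_def]
  from bc(6,7) n obtain vs where bv: "b = v # vs" by (cases b) auto
  note gs = gram_schmidt_result[OF bc(2,4,5) ws_def]
  have hdws: "ws ! 0 = v"
    using gram_schmidt_hd[OF v(1), of vs] gs(4) bc(6) n hd_conv_nth[of ws]
    by (cases ws) (auto simp: ws_def bv)
  have len: "length ws = n" using gs(4) bc(6) by simp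
  have dim: "dim_vec (ws ! j) = n" if "j < n" for j
    using gs(3) len nth_mem[of j ws] that by (metis carrier_vecD subsetD)
  \<comment> \<open>length of the \<open>j\<close>-th vector\<close>
  define r where "r j = complex_of_real (sqrt (\<Sum>k<n. (cmod (ws ! j $ k))\<^sup>2))" for j
  have sp: "ws ! j \<bullet>c ws ! i = (\<Sum>k<n. ws ! j $ k * cnj (ws ! i $ k))" if "i < n" "j < n" for i j
    using dim that by (simp add: scalar_prod_def atLeast0LessThan)
  have rr: "ws ! j \<bullet>c ws ! j = r j * r j" if "j < n" for j
  proof -
    have "ws ! j \<bullet>c ws ! j = complex_of_real (\<Sum>k<n. (cmod (ws ! j $ k))\<^sup>2)"
      by (simp add: sp that complex_mult_cnj cmod_power2)
    also have "\<dots> = r j * r j"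
      unfolding r_def of_real_mult[symmetric] by (simp add: sum_nonneg)
    finally show ?thesis .
  qed
  have r0: "r j \<noteq> 0" if "j < n" for j
    using corthogonalD[OF gs(2), of j j] rr[OF that] that len by auto
  have rc: "cnj (r j) = r j" for j by (simp add: r_def)
  define W where "W = mat n n (\<lambda>(i, j). ws ! j $ i / r j)"
  have W: "W \<in> carrier_mat n n" by (simp add: W_def)
  have "mat_adjoint W * W = 1\<^sub>m n"
  proof (rule eq_matI)
    fix i j assume "i < dim_row (1\<^sub>m n)" "j < dim_col (1\<^sub>m n)"
    hence ij: "i < n" "j < n" by auto
    have "(mat_adjoint W * W) $$ (i, j) = (\<Sum>k<n. mat_adjoint W $$ (i, k) * W $$ (k, j))"
      by (rule index_mult_mat_sum) (use W ij in auto)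
    also have "\<dots> = (\<Sum>k<n. ws ! j $ k * cnj (ws ! i $ k) / (r i * r j))"
      by (rule sum.cong) (use ij in \<open>auto simp: W_def mat_adjoint_eq rc\<close>)
    also have "\<dots> = (ws ! j \<bullet>c ws ! i) / (r i * r j)"
      by (simp add: sp ij sum_divide_distrib)
    also have "\<dots> = 1\<^sub>m n $$ (i, j)"
      using corthogonalD[OF gs(2), of j i] ij len rr[of i] r0[of i] by auto
    finally show "(mat_adjoint W * W) $$ (i, j) = 1\<^sub>m n $$ (i, j)" .
  qed (use W in \<open>auto simp: mat_adjoint_eq\<close>)
  moreover have "col W 0 = (1 / r 0) \<cdot>\<^sub>v v"
    by (rule eq_vecI) (use n v in \<open>auto simp: W_def hdws\<close>)
  ultimately show thesis using W that by blast
qed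

lemma mult_four_block_diag:
  fixes A A' D D' :: "'a :: comm_ring_1 mat"
  assumes "A \<in> carrier_mat k k" "D \<in> carrier_mat n n" "A' \<in> carrier_mat k k" "D' \<in> carrier_mat n n"
  shows "four_block_mat A (0\<^sub>m k n) (0\<^sub>m n k) D * four_block_mat A' (0\<^sub>m k n) (0\<^sub>m n k) D'
    = four_block_mat (A * A') (0\<^sub>m k n) (0\<^sub>m n k) (D * D')"
proof -
  have "A * A' + 0\<^sub>m k n * 0\<^sub>m n k = A * A'" "A * 0\<^sub>m k n + 0\<^sub>m k n * D' = 0\<^sub>m k n"
    "0\<^sub>m n k * A' + D * 0\<^sub>m n k = 0\<^sub>m n k" "0\<^sub>m n k * 0\<^sub>m k n + D * D' = D * D'"
    using assms by simp_all
  thus ?thesis using assms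
    by (subst mult_four_block_mat[of _ k k _ n _ n _ _ k _ n]) simp_all
qed

text \<open>The spectral theorem, by deflation: conjugating with a unitary matrix whose first column is an
eigenvector clears the first column below the diagonal, and by symmetry the first row as well, so
that a Hermitian block of size one less remains.\<close>

theorem hermitian_unitary_diagonalization:
  fixes A :: "complex mat"
  assumes "A \<in> carrier_mat n n" "mat_adjoint A = A"
  obtains U l where "U \<in> carrier_mat n n" "mat_adjoint U * U = 1\<^sub>m n"
    "A = U * mat_diag n l * mat_adjoint U"
proof -
  have "\<exists>U l. U \<in> carrier_mat n n \<and> mat_adjoint U * U = 1\<^sub>m n \<and> A = U * mat_diag n l * mat_adjoint U"
    using assms
  proof (induction n arbitrary: A)
    case 0
    then show ?case by (intro exI[of _ "1\<^sub>m 0"]) (auto intro!: eq_matI simp: mat_adjoint_eq)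
  next
    case (Suc n)
    note A = Suc.prems(1)
    obtain e where "eigenvalue A e"
      using spectrum_non_empty[OF A] by (auto simp: spectrum_def)
    then obtain v where v: "v \<in> carrier_vec (Suc n)" "v \<noteq> 0\<^sub>v (Suc n)" "A *\<^sub>v v = e \<cdot>\<^sub>v v"
      using A by (auto simp: eigenvalue_def eigenvector_def)
    obtain W c where W: "W \<in> carrier_mat (Suc n) (Suc n)" "mat_adjoint W * W = 1\<^sub>m (Suc n)"
      "col W 0 = c \<cdot>\<^sub>v v"
      using unitary_with_first_column[OF v(1,2)] by blast
    have W': "mat_adjoint W \<in> carrier_mat (Suc n) (Suc n)" using W by simp
    have WW: "W * mat_adjoint W = 1\<^sub>m (Suc n)"
      using mat_mult_left_right_inverse[OF W' W(1,2)] .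
    define B where "B = mat_adjoint W * A * W"
    have B: "B \<in> carrier_mat (Suc n) (Suc n)"
      unfolding B_def using A W W' by (intro mult_carrier_mat[of _ "Suc n" "Suc n"]) auto
    have Bh: "mat_adjoint B = B"
      unfolding B_def using A W(1) W' Suc.prems(2)
      by (simp add: mat_adjoint_mult[of _ "Suc n" "Suc n" _ "Suc n"]
          assoc_mult_mat[of _ "Suc n" "Suc n" _ "Suc n"])
    have Aw: "A *\<^sub>v col W 0 = e \<cdot>\<^sub>v col W 0"
      unfolding W(3) using v A by (simp add: mult_mat_vec smult_smult_assoc mult.commute)
    have W0: "col W 0 \<in> carrier_vec (Suc n)"
      using W(1) by (metis carrier_matD(1) col_dim)
    have "col B 0 = (mat_adjoint W * A) *\<^sub>v col W 0"
      unfolding B_def using W A W'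
      by (intro col_mult2[of _ "Suc n" "Suc n" _ "Suc n"] mult_carrier_mat[of _ "Suc n" "Suc n"]) auto
    also have "\<dots> = mat_adjoint W *\<^sub>v (A *\<^sub>v col W 0)"
      using W0 A W' by (intro assoc_mult_mat_vec[of _ "Suc n" "Suc n" _ "Suc n"]) auto
    also have "\<dots> = e \<cdot>\<^sub>v (mat_adjoint W *\<^sub>v col W 0)"
      unfolding Aw using W0 W' by (intro mult_mat_vec[of _ "Suc n" "Suc n"]) auto
    also have "mat_adjoint W *\<^sub>v col W 0 = col (mat_adjoint W * W) 0"
      using W W' by (intro col_mult2[of _ "Suc n" "Suc n" _ "Suc n", symmetric]) auto
    finally have B0: "col B 0 = e \<cdot>\<^sub>v unit_vec (Suc n) 0" using W(2) by simp
    have Bcol: "B $$ (i, 0) = (if i = 0 then e else 0)" if "i < Suc n" for i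
      using arg_cong[OF B0, of "\<lambda>u. u $ i"] that B by auto
    have Bsym: "B $$ (i, j) = cnj (B $$ (j, i))" if "i < Suc n" "j < Suc n" for i j
      using arg_cong[OF Bh, of "\<lambda>M. M $$ (i, j)"] that B by (auto simp: mat_adjoint_eq)
    define C where "C = mat n n (\<lambda>(i, j). B $$ (Suc i, Suc j))"
    have C: "C \<in> carrier_mat n n" by (simp add: C_def)
    have "mat_adjoint C = C"
      by (rule eq_matI) (auto simp: mat_adjoint_eq C_def Bsym[symmetric])
    then obtain V l where V: "V \<in> carrier_mat n n" "mat_adjoint V * V = 1\<^sub>m n"
      "C = V * mat_diag n l * mat_adjoint V"
      using Suc.IH[OF C] by blast
    define V1 where "V1 = four_block_mat (1\<^sub>m 1) (0\<^sub>m 1 n) (0\<^sub>m n 1) V"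
    define l1 where "l1 i = (case i of 0 \<Rightarrow> e | Suc j \<Rightarrow> l j)" for i
    have V1: "V1 \<in> carrier_mat (Suc n) (Suc n)"
      using four_block_carrier_mat[OF one_carrier_mat V(1), of 1] by (auto simp: V1_def)
    have V1a: "mat_adjoint V1 = four_block_mat (1\<^sub>m 1) (0\<^sub>m 1 n) (0\<^sub>m n 1) (mat_adjoint V)"
      by (rule eq_matI) (use V in \<open>auto simp: V1_def mat_adjoint_eq\<close>)
    have V1u: "mat_adjoint V1 * V1 = 1\<^sub>m (Suc n)"
      unfolding V1a unfolding V1_def
      using V mult_four_block_diag[of "1\<^sub>m 1" 1 "mat_adjoint V" n "1\<^sub>m 1" V] by simp
    have D: "mat_diag (Suc n) l1 = four_block_mat (mat_diag 1 (\<lambda>_. e)) (0\<^sub>m 1 n) (0\<^sub>m n 1) (mat_diag n l)"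
      by (rule eq_matI) (auto simp: mat_diag_def l1_def split: nat.split)
    have "V1 * mat_diag (Suc n) l1 * mat_adjoint V1
        = four_block_mat (mat_diag 1 (\<lambda>_. e)) (0\<^sub>m 1 n) (0\<^sub>m n 1) (V * mat_diag n l * mat_adjoint V)"
      unfolding V1a D unfolding V1_def
      using V mult_four_block_diag[of "1\<^sub>m 1" 1 V n "mat_diag 1 (\<lambda>_. e)" "mat_diag n l"]
        mult_four_block_diag[of "mat_diag 1 (\<lambda>_. e)" 1 "V * mat_diag n l" n "1\<^sub>m 1" "mat_adjoint V"]
        left_mult_one_mat[OF mat_diag_dim, of 1 "\<lambda>_. e"] right_mult_one_mat[OF mat_diag_dim, of 1 "\<lambda>_. e"]
      by simp
    also have "\<dots> = B"
      unfolding V(3)[symmetric]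
    proof (rule eq_matI)
      fix i j assume "i < dim_row B" "j < dim_col B"
      hence ij: "i < Suc n" "j < Suc n" using B by auto
      show "four_block_mat (mat_diag 1 (\<lambda>_. e)) (0\<^sub>m 1 n) (0\<^sub>m n 1) C $$ (i, j) = B $$ (i, j)"
        using ij C Bcol[of i] Bcol[of j] Bsym[of 0 j]
        by (cases i; cases j) (auto simp: mat_diag_def C_def)
    qed (use B C in \<open>auto simp: mat_diag_def\<close>)
    finally have BV: "B = V1 * mat_diag (Suc n) l1 * mat_adjoint V1" ..
    define U where "U = W * V1"
    have U: "U \<in> carrier_mat (Suc n) (Suc n)" using W V1 by (simp add: U_def)
    have Ua: "mat_adjoint U = mat_adjoint V1 * mat_adjoint W"
      unfolding U_def using W V1 by (intro mat_adjoint_mult) auto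
    have V1': "mat_adjoint V1 \<in> carrier_mat (Suc n) (Suc n)" using V1 by simp
    note assoc = assoc_mult_mat[of _ "Suc n" "Suc n" _ "Suc n" _ "Suc n"]
      mult_carrier_mat[of _ "Suc n" "Suc n" _ "Suc n"]
    have "mat_adjoint U * U = mat_adjoint V1 * (mat_adjoint W * W) * V1"
      unfolding Ua unfolding U_def using W(1) W' V1 V1' by (simp add: assoc)
    hence Uu: "mat_adjoint U * U = 1\<^sub>m (Suc n)" using W(2) V1u V1' by simp
    have "U * mat_diag (Suc n) l1 * mat_adjoint U = W * B * mat_adjoint W"
      unfolding Ua unfolding U_def BV using W(1) W' V1 V1' by (simp add: assoc)
    also have "\<dots> = (W * mat_adjoint W) * A * (W * mat_adjoint W)"
      unfolding B_def using W(1) W' A by (simp add: assoc)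
    also have "\<dots> = A" unfolding WW using A by simp
    finally show ?case using U Uu by (intro exI[of _ U] exI[of _ l1]) simp
  qed
  thus thesis using that by blast
qed

lemma char_poly_unitary_diagonalization:
  fixes U :: "complex mat"
  assumes U: "U \<in> carrier_mat n n" "mat_adjoint U * U = 1\<^sub>m n"
  shows "char_poly (U * mat_diag n l * mat_adjoint U) = (\<Prod>a\<leftarrow>map l [0..<n]. [:- a, 1:])"
proof -
  have U': "mat_adjoint U \<in> carrier_mat n n" using U by simp
  have UU: "U * mat_adjoint U = 1\<^sub>m n"
    using mat_mult_left_right_inverse[OF U' U] .
  have "U * mat_diag n l * mat_adjoint U \<in> carrier_mat n n"
    using U U' by (intro mult_carrier_mat[of _ n n]) auto
  with U U' UU have "similar_mat (U * mat_diag n l * mat_adjoint U) (mat_diag n l)"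
    by (intro similar_matI[of _ _ U "mat_adjoint U" n]) auto
  hence "char_poly (U * mat_diag n l * mat_adjoint U) = char_poly (mat_diag n l)"
    by (rule char_poly_similar)
  also have "\<dots> = (\<Prod>a\<leftarrow>diag_mat (mat_diag n l). [:- a, 1:])"
    by (rule char_poly_upper_triangular[of _ n]) (auto simp: mat_diag_def)
  also have "diag_mat (mat_diag n l) = map l [0..<n]"
    by (auto simp: diag_mat_def mat_diag_def)
  finally show ?thesis .
qed

lemma order_prod_list_linear:
  "Polynomial.order x (\<Prod>a\<leftarrow>as. [:- a, 1:]) = count_list as (x :: 'a :: idom)"
proof (induction as)
  case (Cons a as)
  have "prod_list (map (\<lambda>a. [:- a, 1:]) as) \<noteq> 0"
    by (auto simp: prod_list_zero_iff)
  thus ?case using Cons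
    by (simp add: order_mult order_linear' del: mult_pCons_left)
qed simp

lemma sum_list_map_eq_sum_count_list:
  fixes f :: "'a \<Rightarrow> real"
  assumes "finite S" "set xs \<subseteq> S"
  shows "sum_list (map f xs) = (\<Sum>x\<in>S. real (count_list xs x) * f x)"
  using assms(2)
proof (induction xs)
  case (Cons a xs)
  have "(\<Sum>x\<in>S. real (count_list (a # xs) x) * f x)
      = (\<Sum>x\<in>S. real (count_list xs x) * f x + (if x = a then f x else 0))"
    by (rule sum.cong) (auto simp: algebra_simps)
  also have "\<dots> = (\<Sum>x\<in>S. real (count_list xs x) * f x) + f a"
    using assms(1) Cons.prems by (simp add: sum.distrib)
  finally show ?case using Cons by simp
qed simp

text \<open>Passes from the sum over distinct eigenvalues, weighted by algebraic multiplicity, to a sum over the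
diagonal, where every eigenvalue is listed as often as it occurs.\<close>

lemma matrix_energy_unitary_diagonalization:
  assumes U: "U \<in> carrier_mat n n" "mat_adjoint U * U = 1\<^sub>m n"
  shows "matrix_energy (U * mat_diag n l * mat_adjoint U) = (\<Sum>i<n. cmod (l i))"
proof -
  let ?A = "U * mat_diag n l * mat_adjoint U"
  have A: "?A \<in> carrier_mat n n" using U by (intro mult_carrier_mat[of _ n n]) auto
  note cp = char_poly_unitary_diagonalization[OF U]
  have sp: "spectrum ?A = set (map l [0..<n])"
    unfolding spectrum_root_char_poly[OF A] cp by (auto simp: poly_prod_list prod_list_zero_iff)
  have "(\<Sum>i<n. cmod (l i)) = sum_list (map cmod (map l [0..<n]))"
    by (simp add: interv_sum_list_conv_sum_set_nat atLeast0LessThan o_def)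
  also have "\<dots> = (\<Sum>x\<in>set (map l [0..<n]). real (count_list (map l [0..<n]) x) * cmod x)"
    by (rule sum_list_map_eq_sum_count_list) simp_all
  finally show ?thesis
    unfolding matrix_energy_def sp cp order_prod_list_linear by simp
qed

section \<open>Energy and Hermitian involutions\<close>

text \<open>The easy half of the duality between trace norm and operator norm. In an eigenbasis of \<open>A\<close> the trace
of \<open>A X\<close> is \<open>\<Sum>i. l i * Y i i\<close>, with \<open>Y\<close> the matrix of \<open>X\<close> in that basis. As \<open>Y\<close> is again a Hermitian involution,
its rows are unit vectors, hence its diagonal entries have modulus at most 1.\<close>

theorem trace_mult_involution_le_energy:
  assumes A: "A \<in> carrier_mat n n" "mat_adjoint A = A"
    and X: "X \<in> carrier_mat n n" "mat_adjoint X = X" "X * X = 1\<^sub>m n"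
  shows "Re (mat_trace (A * X)) \<le> matrix_energy A"
proof -
  obtain U l where U: "U \<in> carrier_mat n n" "mat_adjoint U * U = 1\<^sub>m n"
    and AU: "A = U * mat_diag n l * mat_adjoint U"
    using hermitian_unitary_diagonalization[OF A] .
  have U': "mat_adjoint U \<in> carrier_mat n n" using U by simp
  have UU: "U * mat_adjoint U = 1\<^sub>m n"
    using mat_mult_left_right_inverse[OF U' U] .
  note assoc = assoc_mult_mat[of _ n n _ n _ n] mult_carrier_mat[of _ n n _ n]
  define Y where "Y = mat_adjoint U * X * U"
  have Y: "Y \<in> carrier_mat n n"
    unfolding Y_def using U U' X by (intro mult_carrier_mat[of _ n n]) auto
  have "mat_adjoint Y = Y"
    unfolding Y_def using U(1) U' X(1,2)
    by (simp add: mat_adjoint_mult[of _ n n _ n] assoc)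
  hence Ysym: "Y $$ (i, j) = cnj (Y $$ (j, i))" if "i < n" "j < n" for i j
  proof -
    have "Y $$ (i, j) = mat_adjoint Y $$ (i, j)" using \<open>mat_adjoint Y = Y\<close> by simp
    also have "\<dots> = cnj (Y $$ (j, i))" using that Y by (simp add: mat_adjoint_eq)
    finally show ?thesis .
  qed
  have "Y * Y = mat_adjoint U * X * (U * mat_adjoint U) * X * U"
    unfolding Y_def using U(1) U' X(1) by (simp add: assoc)
  also have "\<dots> = mat_adjoint U * (X * X) * U"
    unfolding UU using U(1) U' X(1) by (simp add: assoc)
  also have "\<dots> = 1\<^sub>m n" unfolding X(3) right_mult_one_mat[OF U'] by (rule U(2))
  finally have YY: "Y * Y = 1\<^sub>m n" .
  have Yle: "cmod (Y $$ (i, i)) \<le> 1" if i: "i < n" for i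
  proof -
    have "complex_of_real (\<Sum>j<n. (cmod (Y $$ (i, j)))\<^sup>2) = (\<Sum>j<n. Y $$ (i, j) * Y $$ (j, i))"
      unfolding of_real_sum
    proof (rule sum.cong)
      fix j assume "j \<in> {..<n}"
      hence "Y $$ (j, i) = cnj (Y $$ (i, j))" using Ysym i by blast
      thus "complex_of_real ((cmod (Y $$ (i, j)))\<^sup>2) = Y $$ (i, j) * Y $$ (j, i)"
        by (simp add: complex_mult_cnj cmod_power2)
    qed simp
    also have "\<dots> = (Y * Y) $$ (i, i)" using index_mult_mat_sum[OF Y Y i i] by simp
    also have "\<dots> = complex_of_real 1" using YY i by simp
    finally have "(\<Sum>j<n. (cmod (Y $$ (i, j)))\<^sup>2) = 1" by (simp only: of_real_eq_iff)
    moreover have "(cmod (Y $$ (i, i)))\<^sup>2 \<le> (\<Sum>j<n. (cmod (Y $$ (i, j)))\<^sup>2)"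
      using i by (intro member_le_sum) auto
    ultimately show ?thesis by (simp add: abs_square_le_1)
  qed
  have "mat_trace (A * X) = mat_trace (U * (mat_diag n l * mat_adjoint U * X))"
    unfolding AU using U(1) U' X(1) by (simp add: assoc)
  also have "\<dots> = mat_trace ((mat_diag n l * mat_adjoint U * X) * U)"
    using U U' X by (intro mat_trace_mult_commute[of _ n n] mult_carrier_mat[of _ n n]) auto
  also have "(mat_diag n l * mat_adjoint U * X) * U = mat_diag n l * Y"
    unfolding Y_def using U(1) U' X(1) by (simp add: assoc)
  also have "mat_trace (mat_diag n l * Y) = (\<Sum>i<n. l i * Y $$ (i, i))"
    unfolding mat_diag_mult_left[OF Y] by (simp add: mat_trace_def)
  finally have "Re (mat_trace (A * X)) \<le> cmod (\<Sum>i<n. l i * Y $$ (i, i))"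
    by (simp only: complex_Re_le_cmod)
  also have "\<dots> \<le> (\<Sum>i<n. cmod (l i) * cmod (Y $$ (i, i)))"
    unfolding norm_mult[symmetric] by (rule norm_sum)
  also have "\<dots> \<le> (\<Sum>i<n. cmod (l i))"
    by (intro sum_mono mult_left_le) (use Yle in auto)
  also have "\<dots> = matrix_energy A"
    unfolding AU by (rule matrix_energy_unitary_diagonalization[OF U, symmetric])
  finally show ?thesis .
qed

lemma hermitian_eigenvalues:
  assumes A: "A \<in> carrier_mat n n" "mat_adjoint A = A"
  obtains l where "\<And>i. i < n \<Longrightarrow> l i \<in> spectrum A" "mat_trace A = (\<Sum>i<n. l i)"
    "matrix_energy A = (\<Sum>i<n. cmod (l i))"
proof -
  obtain U l where U: "U \<in> carrier_mat n n" "mat_adjoint U * U = 1\<^sub>m n"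
    and AU: "A = U * mat_diag n l * mat_adjoint U"
    using hermitian_unitary_diagonalization[OF A] .
  have U': "mat_adjoint U \<in> carrier_mat n n" using U by simp
  have "l i \<in> spectrum A" if "i < n" for i
    unfolding spectrum_root_char_poly[OF A(1)]
    using that by (auto simp: AU char_poly_unitary_diagonalization[OF U] poly_prod_list prod_list_zero_iff)
  moreover have "mat_trace A = (\<Sum>i<n. l i)"
  proof -
    have "mat_trace A = mat_trace (U * (mat_diag n l * mat_adjoint U))"
      unfolding AU using U(1) U' by (simp add: assoc_mult_mat[of _ n n _ n _ n] mult_carrier_mat[of _ n n _ n])
    also have "\<dots> = mat_trace (mat_diag n l * mat_adjoint U * U)"
      using U U' by (intro mat_trace_mult_commute[of _ n n] mult_carrier_mat[of _ n n]) auto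
    also have "mat_diag n l * mat_adjoint U * U = mat_diag n l * 1\<^sub>m n"
      unfolding U(2)[symmetric] using U(1) U' by (simp add: assoc_mult_mat[of _ n n _ n _ n] mult_carrier_mat[of _ n n _ n])
    also have "mat_trace \<dots> = (\<Sum>i<n. l i)"
      by (simp add: mat_trace_def mat_diag_def)
    finally show ?thesis .
  qed
  moreover have "matrix_energy A = (\<Sum>i<n. cmod (l i))"
    unfolding AU by (rule matrix_energy_unitary_diagonalization[OF U])
  ultimately show thesis using that by blast
qed

lemma adjacency_matrix_carrier [simp]:
  "adjacency_matrix G vs \<in> carrier_mat (length vs) (length vs)"
  by (simp add: adjacency_matrix_def)

lemma adjacency_matrix_hermitian:
  assumes "pair_graph G"
  shows "mat_adjoint (adjacency_matrix G vs) = adjacency_matrix G vs"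
proof -
  interpret pair_graph G by fact
  have "(u, v) \<in> parcs G \<longleftrightarrow> (v, u) \<in> parcs G" for u v
    using arcs_symmetric by blast
  thus ?thesis by (intro eq_matI) (auto simp: mat_adjoint_eq adjacency_matrix_def)
qed

text \<open>The preceding bound in a form free of matrices: the vertices are indexed by \<open>I\<close> through \<open>f\<close>, and \<open>H\<close> is
the matrix of a real symmetric involution.\<close>

theorem graph_energy_ge_involution_sum:
  fixes H :: "'i \<Rightarrow> 'i \<Rightarrow> real"
  assumes G: "pair_graph G" and f: "bij_betw f I (pverts G)"
    and sym: "\<And>i j. i \<in> I \<Longrightarrow> j \<in> I \<Longrightarrow> H i j = H j i"
    and inv: "\<And>i k. i \<in> I \<Longrightarrow> k \<in> I \<Longrightarrow> (\<Sum>j\<in>I. H i j * H j k) = of_bool (i = k)"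
  shows "(\<Sum>i\<in>I. \<Sum>j\<in>I. of_bool ((f i, f j) \<in> parcs G) * H i j) \<le> graph_energy G"
proof -
  interpret pair_graph G by fact
  have "finite (pverts G)" by (rule pair_finite_verts)
  hence "finite I" using bij_betw_finite[OF f] by simp
  then obtain xs where xs: "distinct xs" "set xs = I" using finite_distinct_list by blast
  define n where "n = length xs"
  have b: "bij_betw ((!) xs) {..<n} I" using bij_betw_nth[OF xs(1)] xs by (simp add: n_def)
  note reindex = sum.reindex_bij_betw[OF b]
  have xI: "xs ! i \<in> I" if "i < n" for i using that xs by (auto simp: n_def)
  define A where "A = adjacency_matrix G (map f xs)"
  define X where "X = mat n n (\<lambda>(i, j). complex_of_real (H (xs ! i) (xs ! j)))"
  have A: "A \<in> carrier_mat n n" "mat_adjoint A = A"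
    unfolding A_def n_def using adjacency_matrix_hermitian[OF G] adjacency_matrix_carrier[of G "map f xs"]
    by (simp_all only: length_map)
  have X: "X \<in> carrier_mat n n" by (simp add: X_def)
  have Xh: "mat_adjoint X = X"
    by (rule eq_matI) (auto simp: X_def mat_adjoint_eq intro!: sym xI)
  have XX: "X * X = 1\<^sub>m n"
  proof (rule eq_matI)
    fix i k assume "i < dim_row (1\<^sub>m n)" "k < dim_col (1\<^sub>m n)"
    hence ik: "i < n" "k < n" by auto
    have "(X * X) $$ (i, k) = complex_of_real (\<Sum>j<n. H (xs ! i) (xs ! j) * H (xs ! j) (xs ! k))"
      using ik by (subst index_mult_mat_sum[OF X X]) (auto simp: X_def)
    also have "(\<Sum>j<n. H (xs ! i) (xs ! j) * H (xs ! j) (xs ! k)) = of_bool (xs ! i = xs ! k)"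
      using inv[OF xI xI, OF ik] reindex[of "\<lambda>x. H (xs ! i) x * H x (xs ! k)"] by simp
    also have "complex_of_real \<dots> = 1\<^sub>m n $$ (i, k)"
      using ik xs(1) by (auto simp: nth_eq_iff_index_eq n_def)
    finally show "(X * X) $$ (i, k) = 1\<^sub>m n $$ (i, k)" .
  qed (auto simp: X_def)
  have "(\<Sum>i\<in>I. \<Sum>j\<in>I. of_bool ((f i, f j) \<in> parcs G) * H i j)
      = (\<Sum>i<n. \<Sum>j<n. of_bool ((f (xs ! i), f (xs ! j)) \<in> parcs G) * H (xs ! i) (xs ! j))"
    by (subst reindex[symmetric], rule sum.cong[OF refl], subst reindex[symmetric], rule refl)
  also have "\<dots> = Re (mat_trace (A * X))"
  proof -
    have "mat_trace (A * X) = (\<Sum>i<n. \<Sum>j<n. A $$ (i, j) * X $$ (j, i))"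
      unfolding mat_trace_def using A X by (simp add: index_mult_mat_sum[OF A(1) X] del: index_mult_mat(1))
    also have "\<dots> = complex_of_real
        (\<Sum>i<n. \<Sum>j<n. of_bool ((f (xs ! i), f (xs ! j)) \<in> parcs G) * H (xs ! i) (xs ! j))"
      unfolding of_real_sum
      by (intro sum.cong refl) (auto simp: A_def adjacency_matrix_def X_def n_def[symmetric] intro!: sym xI)
    finally show ?thesis by simp
  qed
  also have "\<dots> \<le> matrix_energy A"
    by (rule trace_mult_involution_le_energy[OF A X Xh XX])
  also have "\<dots> = graph_energy G"
    unfolding A_def
    by (rule graph_energy_eq[symmetric])
      (use xs f in \<open>auto simp: distinct_map bij_betw_def\<close>)
  finally show ?thesis .
qed

section \<open>Complete graphs\<close>

text \<open>If \<open>v\<close> is an eigenvector and \<open>S\<close> the sum of its entries, the eigenvalue equation says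
\<open>(e + 1) * v i = S\<close> for all \<open>i\<close>. Summing over \<open>i\<close> gives \<open>(e + 1) * S = m * S\<close>.\<close>

lemma spectrum_complete_graph:
  assumes "e \<in> spectrum (adjacency_matrix (complete_graph m) [0..<m])"
  shows "e = -1 \<or> e = of_nat m - 1"
proof (rule disjCI)
  let ?A = "adjacency_matrix (complete_graph m) [0..<m]"
  assume ne: "e \<noteq> of_nat m - 1"
  obtain v where v: "v \<in> carrier_vec m" "v \<noteq> 0\<^sub>v m" "?A *\<^sub>v v = e \<cdot>\<^sub>v v"
    using assms by (auto simp: spectrum_def eigenvalue_def eigenvector_def adjacency_matrix_def)
  define S where "S = (\<Sum>j<m. v $ j)"
  have row: "(e + 1) * v $ i = S" if i: "i < m" for i
  proof -
    have "e * v $ i = (?A *\<^sub>v v) $ i" using v i by simp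
    also have "\<dots> = (\<Sum>j<m. (if i = j then 0 else 1) * v $ j)"
      using i v(1) by (auto simp: adjacency_matrix_def scalar_prod_def complete_graph_def atLeast0LessThan
          intro!: sum.cong)
    also have "\<dots> = (\<Sum>j<m. v $ j - (if j = i then v $ j else 0))"
      by (rule sum.cong) auto
    also have "\<dots> = S - v $ i" using i by (simp add: sum_subtractf S_def)
    finally show ?thesis by (simp add: algebra_simps)
  qed
  have "(e + 1) * S = (\<Sum>i<m. (e + 1) * v $ i)" by (simp add: S_def sum_distrib_left)
  also have "\<dots> = of_nat m * S" using row by simp
  finally have "S = 0 \<or> e + 1 = of_nat m" by simp
  moreover have "e + 1 \<noteq> of_nat m"
  proof
    assume "e + 1 = of_nat m"
    hence "e = of_nat m - 1" by (simp only: eq_diff_eq)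
    with ne show False by contradiction
  qed
  ultimately have "S = 0" by blast
  show "e = -1"
  proof (rule ccontr)
    assume "e \<noteq> -1"
    hence "e + 1 \<noteq> 0" by (metis add_eq_0_iff2 add.commute)
    hence "v = 0\<^sub>v m" using row v(1) \<open>S = 0\<close> by (intro eq_vecI) auto
    with v show False by simp
  qed
qed

text \<open>On the two possible eigenvalues \<open>-1\<close> and \<open>m - 1\<close> the modulus agrees with an affine function, so the
energy is the corresponding affine function of the trace, which is 0.\<close>

lemma graph_energy_complete_graph:
  assumes "m \<ge> 1"
  shows "graph_energy (complete_graph m) = 2 * (real m - 1)"
proof -
  let ?A = "adjacency_matrix (complete_graph m) [0..<m]"
  have A: "?A \<in> carrier_mat m m" by (simp add: adjacency_matrix_def)
  have "mat_adjoint ?A = ?A"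
    by (rule eq_matI) (auto simp: mat_adjoint_eq adjacency_matrix_def complete_graph_def)
  then obtain l where l: "\<And>i. i < m \<Longrightarrow> l i \<in> spectrum ?A" "mat_trace ?A = (\<Sum>i<m. l i)"
    "matrix_energy ?A = (\<Sum>i<m. cmod (l i))"
    using hermitian_eigenvalues[OF A] by blast
  have tr: "(\<Sum>i<m. l i) = 0"
    unfolding l(2)[symmetric] by (simp add: mat_trace_def adjacency_matrix_def complete_graph_def)
  have val: "cmod (l i) = 1 + (Re (l i) + 1) * ((real m - 2) / real m)" if "i < m" for i
  proof -
    have "cmod (of_nat m - 1) = real m - 1"
      using assms norm_of_real[of "real m - 1", where 'a = complex] by simp
    moreover have "Re (of_nat m - 1) = real m - 1" by simp
    moreover have "l i = -1 \<or> l i = of_nat m - 1"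
      using spectrum_complete_graph[OF l(1)[OF that]] .
    moreover have "real m - 1 = 1 + (real m - 1 + 1) * ((real m - 2) / real m)"
      using assms by simp
    ultimately show ?thesis by (elim disjE) (simp_all del: of_nat_diff)
  qed
  have "matrix_energy ?A = (\<Sum>i<m. 1 + (Re (l i) + 1) * ((real m - 2) / real m))"
    unfolding l(3) using val by simp
  also have "\<dots> = real m + (Re (\<Sum>i<m. l i) + real m) * ((real m - 2) / real m)"
    by (simp add: sum.distrib sum_distrib_right[symmetric] sum_divide_distrib[symmetric])
  also have "\<dots> = 2 * (real m - 1)"
    unfolding tr using assms by simp
  finally have "matrix_energy ?A = 2 * (real m - 1)" .
  moreover have "graph_energy (complete_graph m) = matrix_energy ?A"
    by (rule graph_energy_eq) (auto simp: complete_graph_def)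
  ultimately show ?thesis by simp
qed

section \<open>Blow-ups of the incidence relation on ordered pairs\<close>

lemma sum_prod_pairs:
  fixes f g :: "'a \<Rightarrow> 'b \<Rightarrow> real"
  shows "(\<Sum>(a, b)\<in>A \<times> A'. \<Sum>(c, d)\<in>B \<times> B'. f a d * g b c)
    = (\<Sum>a\<in>A. \<Sum>d\<in>B'. f a d) * (\<Sum>b\<in>A'. \<Sum>c\<in>B. g b c)"
proof -
  have "(\<Sum>(c, d)\<in>B \<times> B'. f a d * g b c) = (\<Sum>d\<in>B'. f a d) * (\<Sum>c\<in>B. g b c)" for a b
    by (simp only: sum.cartesian_product[symmetric] sum_distrib_right[symmetric] sum_distrib_left[symmetric])
  thus ?thesis by (simp add: sum.cartesian_product[symmetric] sum_product)
qed

definition delta :: "'a \<Rightarrow> 'a \<Rightarrow> real" where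
  "delta x y = of_bool (x = y)"

text \<open>The matrix of the orthogonal projection of \<open>\<real>\<^sup>L\<close> onto the vectors with coordinate sum 0.\<close>

definition centering :: "'a set \<Rightarrow> 'a \<Rightarrow> 'a \<Rightarrow> real" where
  "centering L x y = delta x y - 1 / real (card L)"

lemma sum_delta:
  assumes "finite L"
  shows "a \<in> L \<Longrightarrow> (\<Sum>x\<in>L. delta a x * g x) = g a" "b \<in> L \<Longrightarrow> (\<Sum>x\<in>L. g x * delta x b) = g b"
    "a \<in> L \<Longrightarrow> (\<Sum>x\<in>L. delta a x) = 1" "b \<in> L \<Longrightarrow> (\<Sum>x\<in>L. delta x b) = 1"
  using assms by (simp_all add: delta_def of_bool_def if_distrib[of "\<lambda>t. t * _"] if_distrib[of "\<lambda>t. _ * t"] cong: if_cong)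

lemma sum_centering:
  assumes "finite L" "a \<in> L"
  shows "(\<Sum>x\<in>L. centering L a x) = 0"
proof -
  have "card L \<noteq> 0" using assms by auto
  thus ?thesis using assms by (simp add: centering_def sum_subtractf sum_delta)
qed

lemma centering_idem:
  assumes "finite L" "a \<in> L" "b \<in> L"
  shows "(\<Sum>x\<in>L. centering L a x * centering L x b) = centering L a b"
proof -
  have "(\<Sum>x\<in>L. centering L a x * centering L x b)
      = (\<Sum>x\<in>L. centering L a x * delta x b) - (\<Sum>x\<in>L. centering L a x) / real (card L)"
    by (simp add: centering_def[of L _ b] right_diff_distrib sum_subtractf sum_divide_distrib)
  thus ?thesis using assms by (simp add: sum_delta sum_centering)
qed

text \<open>The sign, in the sense of functional calculus, of the symmetric matrix that has a 1 at
\<open>((a, b), (a', b'))\<close> iff \<open>b = a'\<close> or \<open>b' = a\<close>. On functions of \<open>(a, b)\<close> whose sum over each of the variables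
vanishes, that matrix is the negative of the swap \<open>(a, b) \<mapsto> (b, a)\<close>; on the orthogonal complement, the
functions \<open>x a + y b\<close>, its sign is the swap itself. Hence the formula: the swap after the identity
minus twice the projection \<open>centering L \<otimes> centering L\<close>.\<close>

definition swap_reflection :: "'a set \<Rightarrow> 'a \<times> 'a \<Rightarrow> 'a \<times> 'a \<Rightarrow> real" where
  "swap_reflection L = (\<lambda>(a, b) (a', b').
     delta a b' * delta b a' - 2 * (centering L a b' * centering L b a'))"

lemma swap_reflection_involution:
  assumes L: "finite L" and pr: "p \<in> L \<times> L" "r \<in> L \<times> L"
  shows "(\<Sum>s\<in>L \<times> L. swap_reflection L p s * swap_reflection L s r) = delta p r"
proof -
  obtain a b a' b' where p: "p = (a, b)" "a \<in> L" "b \<in> L" and r: "r = (a', b')" "a' \<in> L" "b' \<in> L"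
    using pr by auto
  let ?z = "centering L"
  have split: "(\<Sum>x\<in>L. \<Sum>y\<in>L. f y * g x) = (\<Sum>y\<in>L. f y) * (\<Sum>x\<in>L. g x)" for f g :: "'a \<Rightarrow> real"
    by (simp only: sum_distrib_right[symmetric] sum_distrib_left[symmetric])
  have "(\<Sum>s\<in>L \<times> L. swap_reflection L p s * swap_reflection L s r)
     = (\<Sum>(x, y)\<in>L \<times> L. (delta a y * delta y a') * (delta b x * delta x b')
          - 2 * ((delta a y * ?z y a') * (delta b x * ?z x b'))
          - 2 * ((?z a y * delta y a') * (?z b x * delta x b'))
          + 4 * ((?z a y * ?z y a') * (?z b x * ?z x b')))"
    by (rule sum.cong) (auto simp: swap_reflection_def p r algebra_simps)
  also have "\<dots> = delta a a' * delta b b' - 2 * (?z a a' * ?z b b') - 2 * (?z a a' * ?z b b')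
      + 4 * (?z a a' * ?z b b')"
    unfolding sum.cartesian_product[symmetric] sum.distrib sum_subtractf sum_distrib_left[of 2, symmetric]
      sum_distrib_left[of 4, symmetric] split
    using L p r by (simp only: sum_delta centering_idem)
  also have "\<dots> = delta p r" by (simp add: p r delta_def)
  finally show ?thesis .
qed

lemma swap_reflection_sym: "swap_reflection L p r = swap_reflection L r p"
  by (cases p; cases r) (auto simp: swap_reflection_def centering_def delta_def)

text \<open>The trace norm of the incidence matrix that \<open>swap_reflection L\<close> is the sign of. The sum
factorises over the pairs \<open>(a, b')\<close> and \<open>(b, a')\<close>: the incidence relation fails exactly if \<open>a \<noteq> b'\<close> and
\<open>b \<noteq> a'\<close>, and there \<open>swap_reflection L\<close> has the constant value \<open>- 2 / m\<^sup>2\<close>.\<close>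

lemma sum_incidence_swap_reflection:
  assumes L: "finite L" "L \<noteq> {}"
  defines "m \<equiv> real (card L)"
  shows "(\<Sum>p\<in>L \<times> L. \<Sum>r\<in>L \<times> L. of_bool (snd p = fst r \<or> snd r = fst p) * swap_reflection L p r)
     = m\<^sup>2 + 2 * (m - 1)\<^sup>2"
proof -
  have m: "m > 0" using L by (simp add: m_def card_gt_0_iff)
  let ?z = "centering L"
  define n where "n x y = 1 - delta x y" for x y :: 'a
  have "(\<Sum>p\<in>L \<times> L. \<Sum>r\<in>L \<times> L. of_bool (snd p = fst r \<or> snd r = fst p) * swap_reflection L p r)
     = (\<Sum>(a, b)\<in>L \<times> L. \<Sum>(a', b')\<in>L \<times> L. delta a b' * delta b a' - 2 * (?z a b' * ?z b a')
          + 2 / m\<^sup>2 * (n a b' * n b a'))"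
  proof -
    have "of_bool (snd p = fst r \<or> snd r = fst p) * swap_reflection L p r
       = delta (fst p) (snd r) * delta (snd p) (fst r) - 2 * (?z (fst p) (snd r) * ?z (snd p) (fst r))
         + 2 / m\<^sup>2 * (n (fst p) (snd r) * n (snd p) (fst r))" for p r
      unfolding swap_reflection_def delta_def centering_def n_def m_def[symmetric] case_prod_unfold
      by (cases "fst p = snd r"; cases "snd p = fst r") (auto simp: power2_eq_square)
    thus ?thesis by (simp only: case_prod_unfold)
  qed
  also have "\<dots> = (\<Sum>a\<in>L. \<Sum>b\<in>L. delta a b)\<^sup>2 - 2 * (\<Sum>a\<in>L. \<Sum>b\<in>L. ?z a b)\<^sup>2
      + 2 / m\<^sup>2 * (\<Sum>a\<in>L. \<Sum>b\<in>L. n a b)\<^sup>2"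
    unfolding power2_eq_square[of "sum _ _"] sum_prod_pairs[symmetric]
    by (simp add: case_prod_unfold sum.distrib sum_subtractf sum_distrib_left)
  also have "(\<Sum>a\<in>L. \<Sum>b\<in>L. delta a b) = m"
    using L by (simp add: sum_delta m_def)
  also have "(\<Sum>a\<in>L. \<Sum>b\<in>L. ?z a b) = 0"
    using L by (simp add: sum_centering)
  also have "(\<Sum>a\<in>L. \<Sum>b\<in>L. n a b) = m * (m - 1)"
    using L by (simp add: n_def sum_subtractf sum_delta m_def algebra_simps)
  also have "m\<^sup>2 - 2 * 0\<^sup>2 + 2 / m\<^sup>2 * (m * (m - 1))\<^sup>2 = m\<^sup>2 + 2 * (m - 1)\<^sup>2"
    using m by (simp add: power2_eq_square)
  finally show ?thesis .
qed

text \<open>The graph is the incidence graph on \<open>L \<times> L\<close> with every point replaced by \<open>q\<close> copies and all loops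
removed. The test involution \<open>H\<close> acts as \<open>swap_reflection L\<close> on functions that are constant on each set
of copies, and as \<open>- 1\<close> on functions that sum to 0 over each set of copies: there the adjacency matrix
is \<open>- 1\<close> at the points \<open>(a, a)\<close>, because of the missing loops, and 0 elsewhere.
Off the diagonal \<open>H\<close> agrees with \<open>M = H + 1\<close>. The sum of \<open>M\<close> over the relation with loops is
\<open>q * (m\<^sup>2 + 2 * (m - 1)\<^sup>2 + m)\<close>, and over the loops alone it is \<open>4 - 2 / m\<close>.\<close>

theorem pair_graph_energy_bound:
  fixes f :: "'c \<times> 'l \<times> 'l \<Rightarrow> 'a"
  assumes G: "pair_graph G" and f: "bij_betw f (C \<times> L \<times> L) (pverts G)"
    and C: "finite C" "C \<noteq> {}" and L: "finite L" "L \<noteq> {}"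
    and arcs: "\<And>i j. i \<in> C \<times> L \<times> L \<Longrightarrow> j \<in> C \<times> L \<times> L \<Longrightarrow>
      (f i, f j) \<in> parcs G \<longleftrightarrow> i \<noteq> j \<and> (snd (snd i) = fst (snd j) \<or> snd (snd j) = fst (snd i))"
  defines "q \<equiv> real (card C)" and "m \<equiv> real (card L)"
  shows "q * (m\<^sup>2 + 2 * (m - 1)\<^sup>2 + m) - 4 + 2 / m \<le> graph_energy G"
proof -
  have m: "m > 0" and q: "q > 0" using C L by (simp_all add: m_def q_def card_gt_0_iff)
  let ?P = "L \<times> L"
  let ?I = "C \<times> ?P"
  let ?K = "swap_reflection L"
  have fin: "finite ?P" "finite ?I" using C L by auto
  \<comment> \<open>read as a matrix indexed by the vertices, \<open>M / 2\<close> is the projection onto the eigenspace of \<open>H\<close> for 1\<close>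
  define M where "M p r = (?K p r + delta p r) / q" for p r
  define H where "H i j = M (snd i) (snd j) - delta i j" for i j :: "'c \<times> 'l \<times> 'l"
  define adj where "adj p r \<longleftrightarrow> snd p = fst r \<or> snd r = fst p" for p r :: "'l \<times> 'l"
  have sumI: "(\<Sum>i\<in>?I. g (snd i)) = q * (\<Sum>p\<in>?P. g p)" for g :: "'l \<times> 'l \<Rightarrow> real"
    by (simp add: sum.cartesian_product[symmetric, of _ ?P C] case_prod_unfold q_def
        sum.cartesian_product'[of _ C ?P])
  have qM: "q * M p r = ?K p r + delta p r" for p r using q by (simp add: M_def)
  have Hsym: "H i j = H j i" for i j
    by (auto simp: H_def M_def delta_def swap_reflection_sym)
  have MM: "(\<Sum>s\<in>?P. M p s * M s r) = 2 * M p r / q" if "p \<in> ?P" "r \<in> ?P" for p r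
  proof -
    have "(\<Sum>s\<in>?P. M p s * M s r)
        = (\<Sum>s\<in>?P. ?K p s * ?K s r + ?K p s * delta s r + delta p s * ?K s r + delta p s * delta s r) / q\<^sup>2"
      unfolding sum_divide_distrib by (rule sum.cong) (auto simp: M_def power2_eq_square field_simps)
    also have "\<dots> = (delta p r + ?K p r + ?K p r + delta p r) / q\<^sup>2"
      using fin that L by (simp only: sum.distrib sum_delta swap_reflection_involution)
    also have "\<dots> = 2 * M p r / q" using q by (simp add: M_def power2_eq_square field_simps)
    finally show ?thesis .
  qed
  have HH: "(\<Sum>j\<in>?I. H i j * H j k) = of_bool (i = k)" if "i \<in> ?I" "k \<in> ?I" for i k
  proof -
    have "(\<Sum>j\<in>?I. H i j * H j k) = (\<Sum>j\<in>?I. M (snd i) (snd j) * M (snd j) (snd k)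
        - M (snd i) (snd j) * delta j k - delta i j * M (snd j) (snd k) + delta i j * delta j k)"
      by (rule sum.cong) (auto simp: H_def algebra_simps)
    also have "\<dots> = q * (\<Sum>s\<in>?P. M (snd i) s * M s (snd k)) - M (snd i) (snd k) - M (snd i) (snd k) + delta i k"
      using fin that by (simp only: sum.distrib sum_subtractf sum_delta sumI[of "\<lambda>s. M (snd i) s * M s (snd k)"])
    also have "\<dots> = of_bool (i = k)"
      using that q MM[of "snd i" "snd k"] by (auto simp: delta_def)
    finally show ?thesis .
  qed
  have loops: "(\<Sum>p\<in>?P. of_bool (adj p p) * g p) = (\<Sum>a\<in>L. g (a, a))" for g :: "'l \<times> 'l \<Rightarrow> real"
  proof -
    have "(\<Sum>p\<in>?P. of_bool (adj p p) * g p) = (\<Sum>a\<in>L. \<Sum>b\<in>L. delta a b * g (a, b))"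
      unfolding sum.cartesian_product by (rule sum.cong) (auto simp: adj_def delta_def)
    also have "\<dots> = (\<Sum>a\<in>L. g (a, a))" using L by (simp add: sum_delta)
    finally show ?thesis .
  qed
  have "(\<Sum>i\<in>?I. \<Sum>j\<in>?I. of_bool ((f i, f j) \<in> parcs G) * H i j)
      = (\<Sum>i\<in>?I. \<Sum>j\<in>?I. of_bool (adj (snd i) (snd j)) * M (snd i) (snd j)
           - delta i j * (of_bool (adj (snd j) (snd j)) * M (snd j) (snd j)))"
    by (intro sum.cong refl) (auto simp: arcs adj_def delta_def H_def)
  also have "\<dots> = (\<Sum>i\<in>?I. q * (\<Sum>r\<in>?P. of_bool (adj (snd i) r) * M (snd i) r)
           - of_bool (adj (snd i) (snd i)) * M (snd i) (snd i))"
    by (rule sum.cong[OF refl])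
      (simp only: sum_subtractf sum_delta[OF fin(2)] sumI[of "\<lambda>r. of_bool (adj (snd _) r) * M (snd _) r"])
  also have "\<dots> = q * (\<Sum>p\<in>?P. q * (\<Sum>r\<in>?P. of_bool (adj p r) * M p r) - of_bool (adj p p) * M p p)"
    by (rule sumI)
  also have "\<dots> = q * (\<Sum>p\<in>?P. \<Sum>r\<in>?P. of_bool (adj p r) * (q * M p r)) - (\<Sum>p\<in>?P. of_bool (adj p p) * (q * M p p))"
    by (simp add: sum_subtractf sum_distrib_left algebra_simps)
  also have "(\<Sum>p\<in>?P. \<Sum>r\<in>?P. of_bool (adj p r) * (q * M p r))
      = (\<Sum>p\<in>?P. \<Sum>r\<in>?P. of_bool (adj p r) * ?K p r) + (\<Sum>p\<in>?P. \<Sum>r\<in>?P. delta p r * of_bool (adj r r))"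
    unfolding sum.distrib[symmetric]
    by (intro sum.cong refl) (auto simp: qM delta_def algebra_simps)
  also have "(\<Sum>p\<in>?P. \<Sum>r\<in>?P. of_bool (adj p r) * ?K p r) = m\<^sup>2 + 2 * (m - 1)\<^sup>2"
    unfolding adj_def m_def using L by (rule sum_incidence_swap_reflection)
  also have "(\<Sum>p\<in>?P. \<Sum>r\<in>?P. delta p r * of_bool (adj r r)) = m"
  proof -
    have "(\<Sum>p\<in>?P. \<Sum>r\<in>?P. delta p r * of_bool (adj r r)) = (\<Sum>p\<in>?P. of_bool (adj p p) * 1)"
      by (rule sum.cong[OF refl]) (simp only: sum_delta(1)[OF fin(1)] mult_1_right)
    also have "\<dots> = m" unfolding loops by (simp add: m_def)
    finally show ?thesis .
  qed
  also have "(\<Sum>p\<in>?P. of_bool (adj p p) * (q * M p p)) = (\<Sum>a\<in>L. 2 - 2 * (1 - 1 / m)\<^sup>2)"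
    unfolding loops using q
    by (intro sum.cong refl)
      (auto simp: qM swap_reflection_def delta_def centering_def m_def power2_eq_square)
  also have "(\<Sum>a\<in>L. 2 - 2 * (1 - 1 / m)\<^sup>2) = 4 - 2 / m"
    using m by (simp add: m_def[symmetric] field_simps power2_eq_square)
  finally have "(\<Sum>i\<in>?I. \<Sum>j\<in>?I. of_bool ((f i, f j) \<in> parcs G) * H i j)
      = q * (m\<^sup>2 + 2 * (m - 1)\<^sup>2 + m) - 4 + 2 / m" by (simp add: algebra_simps)
  moreover have "(\<Sum>i\<in>?I. \<Sum>j\<in>?I. of_bool ((f i, f j) \<in> parcs G) * H i j) \<le> graph_energy G"
    by (rule graph_energy_ge_involution_sum[OF G f Hsym HH])
  ultimately show ?thesis by simp
qed

section \<open>Quaternions modulo an odd prime as matrices\<close>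

text \<open>Pigeonhole: among the residues, \<open>x\<^sup>2\<close> and \<open>- y\<^sup>2 - 1\<close> take \<open>(p + 1) / 2\<close> values each, which is too many
for the two sets of values to be disjoint.\<close>

lemma minus_one_sum_two_squares:
  assumes "prime p" "odd p"
  obtains \<alpha> \<beta> :: int where "int p dvd \<alpha>\<^sup>2 + \<beta>\<^sup>2 + 1"
proof -
  have p: "p > 2" using prime_ge_2_nat[of p] assms by (cases "p = 2") auto
  have P: "prime (int p)" using assms by simp
  define S where "S = {0..int (p div 2)}"
  have cardS: "card S = p div 2 + 1" by (simp add: S_def)
  define f g :: "int \<Rightarrow> int" where "f x = x\<^sup>2 mod int p" and "g y = (- y\<^sup>2 - 1) mod int p" for x y
  have inj: "x = y" if xy: "x \<in> S" "y \<in> S" "int p dvd x\<^sup>2 - y\<^sup>2" for x y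
  proof -
    have "int p dvd (x - y) * (x + y)" using xy(3) by (simp add: power2_eq_square algebra_simps)
    hence "int p dvd x - y \<or> int p dvd x + y" using P prime_dvd_mult_iff by blast
    moreover have "\<bar>x - y\<bar> < int p" "x + y < int p" "x + y \<ge> 0"
      using xy assms(2) p unfolding S_def by (auto elim!: oddE)
    ultimately have "x - y = 0 \<or> x + y = 0"
      using zdvd_not_zless[of "x + y" "int p"] dvd_imp_le_int[of "x - y" "int p"] by fastforce
    thus ?thesis using xy(1,2) by (auto simp: S_def)
  qed
  have "inj_on f S"
    by (auto simp: inj_on_def f_def mod_eq_dvd_iff intro: inj)
  moreover have "inj_on g S"
  proof (rule inj_onI)
    fix x y assume "x \<in> S" "y \<in> S" "g x = g y"
    thus "x = y" using inj[of y x] by (auto simp: g_def mod_eq_dvd_iff)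
  qed
  ultimately have card: "card (f ` S) = p div 2 + 1" "card (g ` S) = p div 2 + 1"
    by (simp_all add: card_image cardS)
  have sub: "f ` S \<union> g ` S \<subseteq> {0..<int p}" using p by (auto simp: f_def g_def)
  have "f ` S \<inter> g ` S \<noteq> {}"
  proof
    assume "f ` S \<inter> g ` S = {}"
    hence "card (f ` S \<union> g ` S) = 2 * (p div 2 + 1)"
      using card by (subst card_Un_disjoint) (auto simp: S_def)
    moreover have "card (f ` S \<union> g ` S) \<le> p" using card_mono[OF _ sub] by simp
    ultimately show False using assms(2) by presburger
  qed
  then obtain x y where "f x = g y" by auto
  hence "int p dvd x\<^sup>2 - (- y\<^sup>2 - 1)" by (simp only: f_def g_def mod_eq_dvd_iff)
  thus thesis using that[of x y] by (simp add: algebra_simps)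
qed

text \<open>The quadruple \<open>(a, b, c, d)\<close> is also read as the 2 by 2 matrix with rows \<open>(a, b)\<close> and \<open>(c, d)\<close>.\<close>

definition mat2_mult :: "nat \<Rightarrow> quat \<Rightarrow> quat \<Rightarrow> quat" where
  "mat2_mult n = (\<lambda>(a, b, c, d) (a', b', c', d').
     ((a * a' + b * c') mod int n, (a * b' + b * d') mod int n,
      (c * a' + d * c') mod int n, (c * b' + d * d') mod int n))"

lemma mat2_mult_mod:
  "mat2_mult n (a mod int n, b mod int n, c mod int n, d mod int n)
     (a' mod int n, b' mod int n, c' mod int n, d' mod int n) = mat2_mult n (a, b, c, d) (a', b', c', d')"
  by (simp add: mat2_mult_def; intro conjI mod_add_cong mod_mult_cong mod_mod_trivial refl)

text \<open>Representatives of the points of the projective line over the field with \<open>p\<close> elements, in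
  homogeneous coordinates; the index \<open>p\<close> stands for the point at infinity.\<close>

definition line_rep :: "nat \<Rightarrow> nat \<Rightarrow> int \<times> int" where
  "line_rep p u = (if u = p then (0, 1) else (1, int u))"

text \<open>The matrix \<open>c v w\<^sup>T\<close>, where \<open>v\<close> represents the line \<open>u\<close> and \<open>w\<close> is orthogonal to the representative of
\<open>t\<close>. Thus \<open>u\<close> is the image and \<open>t\<close> the kernel.\<close>

definition rank_one :: "nat \<Rightarrow> int \<times> nat \<times> nat \<Rightarrow> quat" where
  "rank_one p = (\<lambda>(c, u, t). case (line_rep p u, line_rep p t) of ((v1, v2), (w1, w2)) \<Rightarrow>
     (c * v1 * w2 mod int p, - (c * v1 * w1) mod int p, c * v2 * w2 mod int p, - (c * v2 * w1) mod int p))"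

definition box :: "nat \<Rightarrow> quat set" where
  "box p = {0..<int p} \<times> {0..<int p} \<times> {0..<int p} \<times> {0..<int p}"

lemma finite_box: "finite (box p)"
  by (simp add: box_def)

lemma mem_box [simp]:
  "(a, b, c, d) \<in> box p \<longleftrightarrow> a \<in> {0..<int p} \<and> b \<in> {0..<int p} \<and> c \<in> {0..<int p} \<and> d \<in> {0..<int p}"
  by (simp add: box_def)

abbreviation zero4 :: quat where "zero4 \<equiv> (0, 0, 0, 0)"

lemma zero_divisors_lipschitz_ring:
  "x \<in> zero_divisors (lipschitz_ring n) \<longleftrightarrow> x \<in> box n \<and> x \<noteq> zero4 \<and>
     (\<exists>y\<in>box n. y \<noteq> zero4 \<and> (quat_mult n x y = zero4 \<or> quat_mult n y x = zero4))"
  unfolding zero_divisors_def lipschitz_ring_def box_def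
  by (simp only: mem_Collect_eq partial_object.simps monoid.simps ring.simps)

locale split_quaternions =
  fixes p :: nat and \<alpha> \<beta> :: int
  assumes prime: "prime p" and odd: "odd p" and neg_one: "int p dvd \<alpha>\<^sup>2 + \<beta>\<^sup>2 + 1"
begin

lemma p_gt_2: "p > 2"
  using prime_ge_2_nat[of p] prime odd by (cases "p = 2") auto

lemma prime_int: "prime (int p)"
  using prime by simp

lemma dvd_mult_iff: "int p dvd a * b \<longleftrightarrow> int p dvd a \<or> int p dvd b"
  using prime_int by (rule prime_dvd_mult_iff)

lemma not_dvd_1: "\<not> int p dvd 1"
  using p_gt_2 by (auto simp: zdvd1_eq)

lemma not_dvd_unit_range: "c \<in> {1..<int p} \<Longrightarrow> \<not> int p dvd c"
  using zdvd_not_zless by auto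

lemma eq_if_dvd_diff:
  assumes "x \<in> {0..<int p}" "y \<in> {0..<int p}" "int p dvd x - y"
  shows "x = y"
  using assms dvd_imp_le_int[of "x - y" "int p"] by (cases "x = y") auto

text \<open>The isomorphism onto the ring of 2 by 2 matrices that sends \<open>i\<close> to \<open>(0, 1, -1, 0)\<close> and \<open>j\<close> to
\<open>(\<alpha>, \<beta>, \<beta>, -\<alpha>)\<close>; the latter squares to \<open>-1\<close> because \<open>\<alpha>\<^sup>2 + \<beta>\<^sup>2 = -1\<close>.\<close>

definition qmat :: "quat \<Rightarrow> quat" where
  "qmat = (\<lambda>(a, b, c, d). ((a + c * \<alpha> + d * \<beta>) mod int p, (b + c * \<beta> - d * \<alpha>) mod int p,
     (- b + c * \<beta> - d * \<alpha>) mod int p, (a - c * \<alpha> - d * \<beta>) mod int p))"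

lemma qmat_mod:
  "qmat (a mod int p, b mod int p, c mod int p, d mod int p) = qmat (a, b, c, d)"
  by (simp add: qmat_def;
      intro conjI mod_add_cong mod_diff_cong mod_mult_cong mod_minus_cong mod_mod_trivial refl)

text \<open>Both sides have the same coordinates as polynomials up to multiples of \<open>\<alpha>\<^sup>2 + \<beta>\<^sup>2 + 1\<close>.\<close>

lemma qmat_mult: "qmat (quat_mult p x y) = mat2_mult p (qmat x) (qmat y)"
proof -
  obtain a b c d where x: "x = (a, b, c, d)" by (cases x)
  obtain a' b' c' d' where y: "y = (a', b', c', d')" by (cases y)
  let ?N = "\<alpha>\<^sup>2 + \<beta>\<^sup>2 + 1"
  have N: "(A mod int p = B mod int p)" if "A - B = ?N * E" for A B E
    using neg_one that by (simp add: mod_eq_dvd_iff)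
  show ?thesis
    unfolding x y quat_mult_def prod.case qmat_mod
    unfolding qmat_def prod.case mat2_mult_mod
    unfolding mat2_mult_def prod.case
    apply (intro arg_cong2[of _ _ _ _ Pair])
       apply (rule N[of _ _ "- (c * c' + d * d')"], simp add: algebra_simps power2_eq_square)
      apply (rule N[of _ _ "c * d' - d * c'"], simp add: algebra_simps power2_eq_square)
     apply (rule N[of _ _ "d * c' - c * d'"], simp add: algebra_simps power2_eq_square)
    apply (rule N[of _ _ "- (c * c' + d * d')"], simp add: algebra_simps power2_eq_square)
    done
qed

text \<open>An injective map of a finite set into itself is onto, so only the kernel matters. Sums and
differences of the four coordinates isolate \<open>2 a\<close>, \<open>2 b\<close> and the two combinations of \<open>c\<close> and \<open>d\<close>, whose
determinant is \<open>-(\<alpha>\<^sup>2 + \<beta>\<^sup>2) = 1\<close>.\<close>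

lemma qmat_bij: "bij_betw qmat (box p) (box p)"
proof -
  have "qmat ` box p \<subseteq> box p" using p_gt_2 by (auto simp: qmat_def split: prod.splits)
  moreover have "inj_on qmat (box p)"
  proof (rule inj_onI)
    fix x y assume xy: "x \<in> box p" "y \<in> box p" "qmat x = qmat y"
    obtain a b c d where x: "x = (a, b, c, d)" by (cases x)
    obtain a' b' c' d' where y: "y = (a', b', c', d')" by (cases y)
    define A B C D where diffs: "A = a - a'" "B = b - b'" "C = c - c'" "D = d - d'"
    have 1: "int p dvd A + C * \<alpha> + D * \<beta>" and 2: "int p dvd B + C * \<beta> - D * \<alpha>"
      and 3: "int p dvd - B + C * \<beta> - D * \<alpha>" and 4: "int p dvd A - C * \<alpha> - D * \<beta>"
      using xy(3) unfolding x y qmat_def diffs by (auto simp: mod_eq_dvd_iff algebra_simps)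
    have two: "int p dvd z" if "int p dvd 2 * z" for z
    proof -
      have "\<not> int p dvd 2" using p_gt_2 zdvd_not_zless[of 2 "int p"] by simp
      thus ?thesis using that dvd_mult_iff by blast
    qed
    have A: "int p dvd A" by (rule two) (use dvd_add[OF 1 4] in \<open>simp add: algebra_simps\<close>)
    have B: "int p dvd B" by (rule two) (use dvd_diff[OF 2 3] in \<open>simp add: algebra_simps\<close>)
    have s: "int p dvd C * \<alpha> + D * \<beta>" using dvd_diff[OF 1 A] by simp
    have t: "int p dvd C * \<beta> - D * \<alpha>" using dvd_diff[OF 2 B] by simp
    have "C = (\<alpha>\<^sup>2 + \<beta>\<^sup>2 + 1) * C - \<alpha> * (C * \<alpha> + D * \<beta>) - \<beta> * (C * \<beta> - D * \<alpha>)"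
      by (simp add: algebra_simps power2_eq_square)
    hence C: "int p dvd C" using neg_one s t by (metis dvd_diff dvd_mult dvd_mult2)
    have "D = (\<alpha>\<^sup>2 + \<beta>\<^sup>2 + 1) * D - \<beta> * (C * \<alpha> + D * \<beta>) + \<alpha> * (C * \<beta> - D * \<alpha>)"
      by (simp add: algebra_simps power2_eq_square)
    hence D: "int p dvd D" using neg_one s t by (metis dvd_diff dvd_add dvd_mult dvd_mult2)
    show "x = y" using xy A B C D eq_if_dvd_diff unfolding x y diffs by auto
  qed
  ultimately show ?thesis
    using endo_inj_surj[of "box p" qmat] finite_box by (auto simp: bij_betw_def)
qed

lemma qmat_eq_0_iff: "x \<in> box p \<Longrightarrow> qmat x = zero4 \<longleftrightarrow> x = zero4"
proof -
  assume x: "x \<in> box p"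
  have "zero4 \<in> box p" "qmat zero4 = zero4" using p_gt_2 by (auto simp: qmat_def)
  thus ?thesis using x bij_betw_imp_inj_on[OF qmat_bij] by (metis inj_on_eq_iff)
qed

abbreviation lines :: "nat set" where "lines \<equiv> {0..p}"
abbreviation scalars :: "int set" where "scalars \<equiv> {1..<int p}"

lemma line_rep_det_eq_0_iff:
  assumes "u \<in> lines" "t \<in> lines" "line_rep p u = (v1, v2)" "line_rep p t = (w1, w2)"
  shows "int p dvd v1 * w2 - v2 * w1 \<longleftrightarrow> t = u"
proof (cases "u = p \<or> t = p")
  case True
  thus ?thesis using assms not_dvd_1 by (auto simp: line_rep_def split: if_splits)
next
  case False
  thus ?thesis using assms eq_if_dvd_diff[of "int t" "int u"] by (auto simp: line_rep_def)
qed

lemma line_rep_unit: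
  assumes "line_rep p u = (v1, v2)"
  shows "v1 = 1 \<or> v2 = 1"
  using assms by (auto simp: line_rep_def split: if_splits)

text \<open>A product of two matrices of rank one vanishes iff the image of the right factor is the kernel of
the left one.\<close>

lemma rank_one_mult_eq_0_iff:
  assumes "c \<in> scalars" "u \<in> lines" "t \<in> lines" "c' \<in> scalars" "u' \<in> lines" "t' \<in> lines"
  shows "mat2_mult p (rank_one p (c, u, t)) (rank_one p (c', u', t')) = zero4 \<longleftrightarrow> t = u'"
proof -
  obtain v1 v2 where v: "line_rep p u = (v1, v2)" by (cases "line_rep p u")
  obtain w1 w2 where w: "line_rep p t = (w1, w2)" by (cases "line_rep p t")
  obtain v1' v2' where v': "line_rep p u' = (v1', v2')" by (cases "line_rep p u'")
  obtain w1' w2' where w': "line_rep p t' = (w1', w2')" by (cases "line_rep p t'")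
  let ?e = "c * c' * (v1' * w2 - v2' * w1)"
  have "mat2_mult p (rank_one p (c, u, t)) (rank_one p (c', u', t'))
    = (?e * v1 * w2' mod int p, - (?e * v1 * w1') mod int p,
       ?e * v2 * w2' mod int p, - (?e * v2 * w1') mod int p)"
    unfolding rank_one_def prod.case v w v' w' mat2_mult_mod
    unfolding mat2_mult_def prod.case
    by (simp add: algebra_simps)
  hence "mat2_mult p (rank_one p (c, u, t)) (rank_one p (c', u', t')) = zero4
     \<longleftrightarrow> int p dvd ?e * v1 * w2' \<and> int p dvd ?e * v1 * w1' \<and> int p dvd ?e * v2 * w2' \<and> int p dvd ?e * v2 * w1'"
    by (simp add: dvd_eq_mod_eq_0[symmetric])
  also have "\<dots> \<longleftrightarrow> int p dvd ?e"
    using line_rep_unit[OF v] line_rep_unit[OF w'] by auto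
  also have "\<dots> \<longleftrightarrow> int p dvd v1' * w2 - v2' * w1"
    using not_dvd_unit_range assms(1,4) by (simp add: dvd_mult_iff)
  also have "\<dots> \<longleftrightarrow> t = u'"
    by (rule line_rep_det_eq_0_iff[OF assms(5,3) v' w])
  finally show ?thesis .
qed

lemma rank_one_in_box: "rank_one p i \<in> box p"
  using p_gt_2 by (auto simp: rank_one_def split: prod.split)

lemma rank_one_nonzero:
  assumes "c \<in> scalars" "u \<in> lines" "t \<in> lines"
  shows "rank_one p (c, u, t) \<noteq> zero4"
proof
  assume z: "rank_one p (c, u, t) = zero4"
  define t' where "t' = (if t = 0 then p else 0)"
  have "mat2_mult p (rank_one p (c, u, t)) (rank_one p (1, t', t')) = zero4"
    unfolding z by (auto simp: mat2_mult_def split: prod.split)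
  moreover have "1 \<in> scalars" "t' \<in> lines" "t \<noteq> t'" using p_gt_2 by (auto simp: t'_def)
  ultimately show False using rank_one_mult_eq_0_iff[OF assms] by blast
qed

text \<open>Kernel and image of a matrix of rank one are determined by which products with matrices of rank one
vanish; then the scalar can be read off an entry, as each representative has a coordinate 1.\<close>

lemma rank_one_inj: "inj_on (rank_one p) (scalars \<times> lines \<times> lines)"
proof (rule inj_onI)
  fix i j assume ij: "i \<in> scalars \<times> lines \<times> lines" "j \<in> scalars \<times> lines \<times> lines"
    and eq: "rank_one p i = rank_one p j"
  obtain c u t c' u' t' where i: "i = (c, u, t)" and j: "j = (c', u', t')"
    by (cases i; cases j) auto
  have one: "1 \<in> scalars" using p_gt_2 by simp
  have t: "t' = t"
    using rank_one_mult_eq_0_iff[of c u t 1 t t] rank_one_mult_eq_0_iff[of c' u' t' 1 t t] ij one eq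
    unfolding i j by auto
  have u: "u' = u"
    using rank_one_mult_eq_0_iff[of 1 u u c u t] rank_one_mult_eq_0_iff[of 1 u u c' u' t'] ij one eq
    unfolding i j by auto
  obtain v1 v2 where v: "line_rep p u = (v1, v2)" by (cases "line_rep p u")
  obtain w1 w2 where w: "line_rep p t = (w1, w2)" by (cases "line_rep p t")
  have "int p dvd (c - c') * v1 * w2 \<and> int p dvd (c - c') * v1 * w1 \<and>
        int p dvd (c - c') * v2 * w2 \<and> int p dvd (c - c') * v2 * w1"
  proof -
    have "int p dvd - (c * v1 * w1) - - (c' * v1 * w1)" "int p dvd - (c * v2 * w1) - - (c' * v2 * w1)"
      "int p dvd c * v1 * w2 - c' * v1 * w2" "int p dvd c * v2 * w2 - c' * v2 * w2"
      using eq unfolding i j t u rank_one_def prod.case v w by (simp_all only: mod_eq_dvd_iff prod.inject)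
    moreover have "(c - c') * v1 * w1 = - (- (c * v1 * w1) - - (c' * v1 * w1))"
      "(c - c') * v2 * w1 = - (- (c * v2 * w1) - - (c' * v2 * w1))"
      "(c - c') * v1 * w2 = c * v1 * w2 - c' * v1 * w2" "(c - c') * v2 * w2 = c * v2 * w2 - c' * v2 * w2"
      by (simp_all add: algebra_simps)
    ultimately show ?thesis by (simp only: dvd_minus_iff simp_thms)
  qed
  hence "int p dvd c - c'" using line_rep_unit[OF v] line_rep_unit[OF w] by auto
  hence "c = c'" using ij eq_if_dvd_diff[of c c'] unfolding i j by auto
  thus "i = j" using t u by (simp add: i j)
qed

lemma line_rep_exists:
  assumes "\<not> (int p dvd x \<and> int p dvd y)"
  obtains u v1 v2 s where "u \<in> lines" "line_rep p u = (v1, v2)" "\<not> int p dvd s"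
    "int p dvd x - s * v1" "int p dvd y - s * v2"
proof (cases "int p dvd x")
  case True
  thus thesis using that[of p 0 1 y] assms by (simp add: line_rep_def)
next
  case False
  hence "coprime x (int p)" using prime_int by (metis coprime_commute prime_imp_coprime)
  then obtain x' where "[x * x' = 1] (mod int p)" using cong_solve_coprime_int by blast
  hence "int p dvd x * x' - 1" by (simp add: cong_iff_dvd_diff)
  hence 1: "int p dvd (x * x' - 1) * y" by simp
  define u where "u = nat (y * x' mod int p)"
  have u: "int u = y * x' mod int p" "u < p" using p_gt_2 by (simp_all add: u_def nat_less_iff)
  have "int p dvd y * x' - int u" by (simp add: u mod_eq_dvd_iff[symmetric])
  hence "int p dvd x * (y * x' - int u)" by simp
  from dvd_diff[OF this 1] have "int p dvd y - x * int u" by (simp add: algebra_simps)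
  thus thesis using that[of u 1 "int u" x] False u(2) by (simp add: line_rep_def)
qed

text \<open>In a nonzero singular matrix all columns are multiples of a single line representative; the row of
the two multipliers is in turn a multiple of the vector orthogonal to some line representative.\<close>

lemma rank_one_surj:
  assumes X: "(x1, x2, x3, x4) \<in> box p" "(x1, x2, x3, x4) \<noteq> zero4" "int p dvd x1 * x4 - x2 * x3"
  shows "(x1, x2, x3, x4) \<in> rank_one p ` (scalars \<times> lines \<times> lines)"
proof -
  have zero: "x = 0" if "x \<in> {0..<int p}" "int p dvd x" for x
    using eq_if_dvd_diff[of x 0] that by auto
  obtain u v1 v2 s s' where u: "u \<in> lines" "line_rep p u = (v1, v2)"
    and s: "int p dvd x1 - s * v1" "int p dvd x3 - s * v2" "int p dvd x2 - s' * v1" "int p dvd x4 - s' * v2"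
  proof (cases "int p dvd x1 \<and> int p dvd x3")
    case True
    hence "\<not> (int p dvd x2 \<and> int p dvd x4)" using X(1,2) zero by auto
    then obtain u v1 v2 s' where "u \<in> lines" "line_rep p u = (v1, v2)"
      "int p dvd x2 - s' * v1" "int p dvd x4 - s' * v2" by (rule line_rep_exists)
    thus thesis using that[of u v1 v2 0 s'] True by simp
  next
    case False
    then obtain u v1 v2 s where u: "u \<in> lines" "line_rep p u = (v1, v2)" and s0: "\<not> int p dvd s"
      and s: "int p dvd x1 - s * v1" "int p dvd x3 - s * v2" by (rule line_rep_exists)
    have "s * (v1 * x4 - v2 * x2) = (x1 * x4 - x2 * x3) - x4 * (x1 - s * v1) + x2 * (x3 - s * v2)"
      by (simp add: algebra_simps)
    hence "int p dvd s * (v1 * x4 - v2 * x2)" using s X(3) by (metis dvd_add dvd_diff dvd_mult)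
    hence d: "int p dvd v1 * x4 - v2 * x2" using s0 dvd_mult_iff by blast
    show thesis
    proof (cases "v1 = 1")
      case True
      thus thesis using that[OF u s, of x2] d by (simp add: mult.commute)
    next
      case False
      hence "v1 = 0" "v2 = 1" using u by (auto simp: line_rep_def split: if_splits)
      thus thesis using that[OF u s, of x4] d by simp
    qed
  qed
  \<comment> \<open>the vector \<open>(- s', s)\<close> is orthogonal to the row \<open>(s, s')\<close>, so the line it spans is the kernel\<close>
  have "\<not> (int p dvd - s' \<and> int p dvd s)"
  proof
    assume a: "int p dvd - s' \<and> int p dvd s"
    hence "int p dvd s * v1" "int p dvd s * v2" "int p dvd s' * v1" "int p dvd s' * v2" by auto
    hence "int p dvd x1" "int p dvd x2" "int p dvd x3" "int p dvd x4"
      using s by (metis dvd_add diff_add_cancel)+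
    thus False using X(1,2) zero by auto
  qed
  then obtain t w1 w2 c where t: "t \<in> lines" "line_rep p t = (w1, w2)" "\<not> int p dvd c"
    "int p dvd - s' - c * w1" "int p dvd s - c * w2" by (rule line_rep_exists)
  define c' where "c' = c mod int p"
  have "c' \<noteq> 0" "0 \<le> c'" "c' < int p" using t(3) p_gt_2 by (auto simp: c'_def dvd_eq_mod_eq_0)
  hence c': "c' \<in> scalars" by simp
  have "x1 mod int p = c * v1 * w2 mod int p"
    unfolding mod_eq_dvd_iff
    using dvd_add[OF s(1) dvd_mult[OF t(5), of v1]] by (simp add: algebra_simps)
  moreover have "x3 mod int p = c * v2 * w2 mod int p"
    unfolding mod_eq_dvd_iff
    using dvd_add[OF s(2) dvd_mult[OF t(5), of v2]] by (simp add: algebra_simps)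
  moreover have "x2 mod int p = - (c * v1 * w1) mod int p"
    unfolding mod_eq_dvd_iff
    using dvd_diff[OF s(3) dvd_mult[OF t(4), of v1]] by (simp add: algebra_simps)
  moreover have "x4 mod int p = - (c * v2 * w1) mod int p"
    unfolding mod_eq_dvd_iff
    using dvd_diff[OF s(4) dvd_mult[OF t(4), of v2]] by (simp add: algebra_simps)
  moreover have "rank_one p (c', u, t) = (c * v1 * w2 mod int p, - (c * v1 * w1) mod int p,
      c * v2 * w2 mod int p, - (c * v2 * w1) mod int p)"
    unfolding rank_one_def prod.case u t c'_def
    by (intro arg_cong2[of _ _ _ _ Pair] mod_mult_cong mod_minus_cong mod_mod_trivial refl)
  ultimately have "(x1, x2, x3, x4) = rank_one p (c', u, t)" using X(1) by auto
  thus ?thesis using c' u t by blast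
qed

text \<open>Multiplying \<open>X Y = 0\<close> by the adjugate of \<open>X\<close> from the left gives \<open>det X * Y = 0\<close>, and by that of \<open>Y\<close> from
the right \<open>det Y * X = 0\<close>.\<close>

lemma det_dvd_if_mult_eq_0:
  assumes "mat2_mult p (x1, x2, x3, x4) (y1, y2, y3, y4) = zero4"
  shows "(y1, y2, y3, y4) \<in> box p \<Longrightarrow> (y1, y2, y3, y4) \<noteq> zero4 \<Longrightarrow> int p dvd x1 * x4 - x2 * x3"
    "(x1, x2, x3, x4) \<in> box p \<Longrightarrow> (x1, x2, x3, x4) \<noteq> zero4 \<Longrightarrow> int p dvd y1 * y4 - y2 * y3"
proof -
  have zero: "x = 0" if "x \<in> {0..<int p}" "int p dvd x" for x
    using eq_if_dvd_diff[of x 0] that by auto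
  have e: "int p dvd x1 * y1 + x2 * y3" "int p dvd x1 * y2 + x2 * y4"
    "int p dvd x3 * y1 + x4 * y3" "int p dvd x3 * y2 + x4 * y4"
    using assms by (auto simp: mat2_mult_def dvd_eq_mod_eq_0)
  let ?D = "x1 * x4 - x2 * x3" and ?E = "y1 * y4 - y2 * y3"
  { assume y: "(y1, y2, y3, y4) \<in> box p" "(y1, y2, y3, y4) \<noteq> zero4"
    have "?D * y1 = x4 * (x1 * y1 + x2 * y3) - x2 * (x3 * y1 + x4 * y3)"
      "?D * y2 = x4 * (x1 * y2 + x2 * y4) - x2 * (x3 * y2 + x4 * y4)"
      "?D * y3 = x1 * (x3 * y1 + x4 * y3) - x3 * (x1 * y1 + x2 * y3)"
      "?D * y4 = x1 * (x3 * y2 + x4 * y4) - x3 * (x1 * y2 + x2 * y4)"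
      by (simp_all add: algebra_simps)
    hence "int p dvd ?D * y1" "int p dvd ?D * y2" "int p dvd ?D * y3" "int p dvd ?D * y4"
      using e by (metis dvd_diff dvd_mult)+
    thus "int p dvd ?D" using y zero unfolding dvd_mult_iff by auto }
  { assume x: "(x1, x2, x3, x4) \<in> box p" "(x1, x2, x3, x4) \<noteq> zero4"
    have "?E * x1 = y4 * (x1 * y1 + x2 * y3) - y3 * (x1 * y2 + x2 * y4)"
      "?E * x2 = y1 * (x1 * y2 + x2 * y4) - y2 * (x1 * y1 + x2 * y3)"
      "?E * x3 = y4 * (x3 * y1 + x4 * y3) - y3 * (x3 * y2 + x4 * y4)"
      "?E * x4 = y1 * (x3 * y2 + x4 * y4) - y2 * (x3 * y1 + x4 * y3)"
      by (simp_all add: algebra_simps)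
    hence "int p dvd ?E * x1" "int p dvd ?E * x2" "int p dvd ?E * x3" "int p dvd ?E * x4"
      using e by (metis dvd_diff dvd_mult)+
    thus "int p dvd ?E" using x zero unfolding dvd_mult_iff by auto }
qed

lemma zero_divisors_iff:
  "x \<in> zero_divisors (lipschitz_ring p) \<longleftrightarrow> x \<in> box p \<and> qmat x \<in> rank_one p ` (scalars \<times> lines \<times> lines)"
proof
  assume "x \<in> zero_divisors (lipschitz_ring p)"
  then obtain y where x: "x \<in> box p" "x \<noteq> zero4" and y: "y \<in> box p" "y \<noteq> zero4"
    and xy: "quat_mult p x y = zero4 \<or> quat_mult p y x = zero4"
    unfolding zero_divisors_lipschitz_ring by blast
  have q0: "qmat zero4 = zero4" by (simp add: qmat_def)
  have X: "qmat x \<in> box p" "qmat x \<noteq> zero4" and Y: "qmat y \<in> box p" "qmat y \<noteq> zero4"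
    using x y qmat_eq_0_iff bij_betwE[OF qmat_bij] by blast+
  have XY: "mat2_mult p (qmat x) (qmat y) = zero4 \<or> mat2_mult p (qmat y) (qmat x) = zero4"
    using xy q0 by (metis qmat_mult)
  obtain x1 x2 x3 x4 where x4: "qmat x = (x1, x2, x3, x4)" by (cases "qmat x")
  obtain y1 y2 y3 y4 where y4: "qmat y = (y1, y2, y3, y4)" by (cases "qmat y")
  have "int p dvd x1 * x4 - x2 * x3"
    using XY Y det_dvd_if_mult_eq_0 unfolding x4 y4 by blast
  thus "x \<in> box p \<and> qmat x \<in> rank_one p ` (scalars \<times> lines \<times> lines)"
    using x(1) X rank_one_surj unfolding x4 by blast
next
  assume a: "x \<in> box p \<and> qmat x \<in> rank_one p ` (scalars \<times> lines \<times> lines)"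
  then obtain c u t where i: "c \<in> scalars" "u \<in> lines" "t \<in> lines" "qmat x = rank_one p (c, u, t)" by auto
  have one: "1 \<in> scalars" using p_gt_2 by simp
  obtain y where y: "y \<in> box p" "qmat y = rank_one p (1, t, t)"
    using bij_betw_imp_surj_on[OF qmat_bij] rank_one_in_box[of "(1, t, t)"] by (metis imageE)
  have q0: "qmat zero4 = zero4" by (simp add: qmat_def)
  have "x \<noteq> zero4" "y \<noteq> zero4"
    using rank_one_nonzero i y one q0 by metis+
  moreover have "quat_mult p x y = zero4"
  proof -
    have "qmat (quat_mult p x y) = zero4"
      unfolding qmat_mult i(4) y(2) using rank_one_mult_eq_0_iff i one by blast
    moreover have "quat_mult p x y \<in> box p" using p_gt_2 by (auto simp: quat_mult_def split: prod.split)
    ultimately show ?thesis using qmat_eq_0_iff by blast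
  qed
  ultimately show "x \<in> zero_divisors (lipschitz_ring p)"
    using a y(1) unfolding zero_divisors_lipschitz_ring by blast
qed

definition vertex :: "int \<times> nat \<times> nat \<Rightarrow> quat" where
  "vertex i = inv_into (box p) qmat (rank_one p i)"

lemma qmat_vertex: "vertex i \<in> box p" "qmat (vertex i) = rank_one p i"
  using bij_betw_imp_surj_on[OF qmat_bij] rank_one_in_box[of i]
  by (auto simp: vertex_def inv_into_into f_inv_into_f)

lemma bij_betw_vertex:
  "bij_betw vertex (scalars \<times> lines \<times> lines) (zero_divisors (lipschitz_ring p))"
proof (rule bij_betwI')
  fix i j assume "i \<in> scalars \<times> lines \<times> lines" "j \<in> scalars \<times> lines \<times> lines"
  thus "vertex i = vertex j \<longleftrightarrow> i = j"
    using rank_one_inj by (metis inj_onD qmat_vertex(2))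
next
  fix i assume "i \<in> scalars \<times> lines \<times> lines"
  thus "vertex i \<in> zero_divisors (lipschitz_ring p)"
    unfolding zero_divisors_iff using qmat_vertex by auto
next
  fix x assume "x \<in> zero_divisors (lipschitz_ring p)"
  then obtain i where i: "x \<in> box p" "i \<in> scalars \<times> lines \<times> lines" "qmat x = rank_one p i"
    unfolding zero_divisors_iff by blast
  hence "x = vertex i"
    using qmat_vertex[of i] bij_betw_imp_inj_on[OF qmat_bij] by (metis inj_onD)
  thus "\<exists>i\<in>scalars \<times> lines \<times> lines. x = vertex i" using i by blast
qed

lemma vertex_mult_eq_0_iff:
  assumes "i \<in> scalars \<times> lines \<times> lines" "j \<in> scalars \<times> lines \<times> lines"
  shows "quat_mult p (vertex i) (vertex j) = zero4 \<longleftrightarrow> snd (snd i) = fst (snd j)"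
proof -
  have "quat_mult p (vertex i) (vertex j) \<in> box p"
    using p_gt_2 by (auto simp: quat_mult_def split: prod.split)
  hence "quat_mult p (vertex i) (vertex j) = zero4 \<longleftrightarrow> mat2_mult p (rank_one p i) (rank_one p j) = zero4"
    using qmat_eq_0_iff by (metis qmat_mult qmat_vertex(2))
  thus ?thesis using assms rank_one_mult_eq_0_iff by auto
qed

end

section \<open>Hyperenergeticity\<close>

theorem theorem7p4:
  fixes p :: nat
  assumes "prime p" and "odd p"
  defines "G \<equiv> zero_divisor_graph (lipschitz_ring p)"
  shows "graph_energy G > 2 * (real (card (pverts G)) - 1)
       \<and> 2 * (real (card (pverts G)) - 1) = graph_energy (complete_graph (card (pverts G)))"
proof -
  obtain \<alpha> \<beta> :: int where "int p dvd \<alpha>\<^sup>2 + \<beta>\<^sup>2 + 1"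
    using minus_one_sum_two_squares assms(1,2) by blast
  then interpret split_quaternions p \<alpha> \<beta>
    using assms(1,2) by unfold_locales
  let ?I = "scalars \<times> lines \<times> lines"
  have V: "pverts G = zero_divisors (lipschitz_ring p)"
    by (simp add: G_def zero_divisor_graph_def)
  have G: "pair_graph G"
    unfolding G_def by (rule pair_graph_zero_divisor_graph) (simp add: lipschitz_ring_def)
  have f: "bij_betw vertex ?I (pverts G)"
    unfolding V by (rule bij_betw_vertex)
  have arcs: "(vertex i, vertex j) \<in> parcs G \<longleftrightarrow>
      i \<noteq> j \<and> (snd (snd i) = fst (snd j) \<or> snd (snd j) = fst (snd i))"
    if "i \<in> ?I" "j \<in> ?I" for i j
  proof -
    have "vertex i \<in> zero_divisors (lipschitz_ring p)" "vertex j \<in> zero_divisors (lipschitz_ring p)"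
      using bij_betwE[OF bij_betw_vertex] that by blast+
    moreover have "vertex i = vertex j \<longleftrightarrow> i = j"
      using bij_betw_imp_inj_on[OF f] that by (rule inj_on_eq_iff)
    ultimately show ?thesis
      using vertex_mult_eq_0_iff[OF that] vertex_mult_eq_0_iff[OF that(2,1)]
      by (simp add: G_def zero_divisor_graph_def lipschitz_ring_def)
  qed
  define x where "x = real p"
  have x: "x \<ge> 3" using p_gt_2 by (simp add: x_def)
  have "card ?I = (p - 1) * ((p + 1) * (p + 1))"
    using p_gt_2 by (simp add: card_cartesian_product nat_diff_distrib)
  hence cardI: "card (pverts G) = (p - 1) * ((p + 1) * (p + 1))"
    using bij_betw_same_card[OF f] by simp
  have card: "real (card (pverts G)) = (x - 1) * (x + 1)\<^sup>2"
  proof -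
    have "real (p - 1) = x - 1" using p_gt_2 by (simp add: x_def of_nat_diff)
    thus ?thesis unfolding cardI of_nat_mult by (simp add: x_def power2_eq_square add.commute)
  qed
  have "real (card scalars) = x - 1" "real (card lines) = x + 1"
    using p_gt_2 by (simp_all add: x_def nat_diff_distrib of_nat_diff)
  moreover have "real (card scalars) * ((real (card lines))\<^sup>2 + 2 * (real (card lines) - 1)\<^sup>2
      + real (card lines)) - 4 + 2 / real (card lines) \<le> graph_energy G"
    by (rule pair_graph_energy_bound[OF G f _ _ _ _ arcs]) (use p_gt_2 in auto)
  ultimately have "(x - 1) * ((x + 1)\<^sup>2 + 2 * (x + 1 - 1)\<^sup>2 + (x + 1)) - 4 + 2 / (x + 1) \<le> graph_energy G"
    by (simp only:)
  moreover have "(x - 1) * ((x + 1)\<^sup>2 + 2 * (x + 1 - 1)\<^sup>2 + (x + 1)) - 4 + 2 / (x + 1)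
      = 2 * ((x - 1) * (x + 1)\<^sup>2 - 1) + (x * (x - 1)\<^sup>2 - 2 + 2 / (x + 1))"
    by (simp add: algebra_simps power2_eq_square)
  moreover have "x * (x - 1)\<^sup>2 - 2 + 2 / (x + 1) > 0"
  proof -
    have "3 * 2\<^sup>2 \<le> x * (x - 1)\<^sup>2"
      using x by (intro mult_mono power_mono) auto
    hence "12 \<le> x * (x - 1)\<^sup>2" by simp
    moreover have "2 / (x + 1) > 0" using x by simp
    ultimately show ?thesis by linarith
  qed
  ultimately have "graph_energy G > 2 * (real (card (pverts G)) - 1)"
    unfolding card by linarith
  moreover have "card (pverts G) \<ge> 1"
    unfolding cardI using p_gt_2 by simp
  ultimately show ?thesis
    using graph_energy_complete_graph by simp
qed

end
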